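(* For every $n\ge1$, the labeling $\lambda_{\mathcal{NC}}$ is an EW-labeling of the noncrossing partition lattice $\mathcal{NC}_n$. Hence $Q_{\lambda_{\mathcal{NC}}}(\mathcal{NC}_n)$ is a Whitney dual of $\mathcal{NC}_n$.
   Context: A partition of $[n]$ is noncrossing if there are no $a<b<c<d$ with $a,c$ in one block and $b,d$ in a different block. $\mathcal{NC}_n$ is the set of noncrossing partitions of $[n]$ ordered by refinement; a cover $\pi\lessdot\sigma$ merges two blocks $B_i,B_j$ of $\pi$. If $\min B_i<\min B_j$, set $\lambda_{\mathcal{NC}}(\pi\lessdot\sigma)=\max\{a\in B_i: a<\min B_j\}$, an integer (labels ordered as integers). E-labelings: words of labels of saturated chains are read bottom to top; increasing = strictly increasing; ascent-free = no consecutive labels $a<b$. ER-labeling: every closed interval has exactly one increasing maximal chain. Rank two switching property: for every saturated chain $\hat0=x_0\lessdot\cdots\lessdot x_k$ and $i$ with $\lambda(x_{i-1}\lessdot x_i)<\lambda(x_i\lessdot x_{i+1})$ there is a unique $x_i'$ with $x_{i-1}\lessdot x_i'\lessdot x_{i+1}$, $\lambda(x_{i-1}\lessdot x_i')=\lambda(x_i\lessdot x_{i+1})$, $\lambda(x_i'\lessdot x_{i+1})=\lambda(x_{i-1}\lessdot x_i)$. EW-labeling: ER-labeling with the rank two switching property such that in each interval distinct maximal chains have distinct label words. $Q_\lambda(P)$: $C(P)$ is the set of saturated chains from $\hat0$ ordered by inclusion; $\mathbf c_1\sim_\lambda\mathbf c_2$ iff they end at the same $y$ and are connected by quadratic exchanges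 (replacing $x_i$ by $x_i'$ at an ascent, forwards or backwards) among maximal chains of $[\hat0,y]$; $Q_\lambda(P)$ is the set of classes ordered by the transitive closure of: $X\le Y$ if some $\mathbf c\in X$, $\mathbf d\in Y$ have $\mathbf c\subseteq\mathbf d$. Whitney numbers: $w_k(P)=\sum_{\rho(x)=k}\mu(\hat0,x)$, $W_k(P)=|\{x:\rho(x)=k\}|$; $P,Q$ are Whitney duals if $|w_k(P)|=W_k(Q)$ and $|w_k(Q)|=W_k(P)$ for all $k$. *)

theory Defs
  imports Main "HOL-Library.Disjoint_Sets"
begin

definition is_poset :: "'a set \<Rightarrow> ('a \<Rightarrow> 'a \<Rightarrow> bool) \<Rightarrow> bool" where
  "is_poset P le \<longleftrightarrow>
     (\<forall>x\<in>P. le x x) \<and>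
     (\<forall>x\<in>P. \<forall>y\<in>P. le x y \<and> le y x \<longrightarrow> x = y) \<and>
     (\<forall>x\<in>P. \<forall>y\<in>P. \<forall>z\<in>P. le x y \<and> le y z \<longrightarrow> le x z)"

definition covers :: "'a set \<Rightarrow> ('a \<Rightarrow> 'a \<Rightarrow> bool) \<Rightarrow> 'a \<Rightarrow> 'a \<Rightarrow> bool" where
  "covers P le x y \<longleftrightarrow> x \<in> P \<and> y \<in> P \<and> le x y \<and> x \<noteq> y \<and>
     \<not> (\<exists>z\<in>P. le x z \<and> le z y \<and> z \<noteq> x \<and> z \<noteq> y)"

definition is_sat_chain :: "'a set \<Rightarrow> ('a \<Rightarrow> 'a \<Rightarrow> bool) \<Rightarrow> 'a list \<Rightarrow> bool" where
  "is_sat_chain P le c \<longleftrightarrow> c \<noteq> [] \<and> set c \<subseteq> P \<and>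
     (\<forall>i. Suc i < length c \<longrightarrow> covers P le (c ! i) (c ! Suc i))"

definition maxchain :: "'a set \<Rightarrow> ('a \<Rightarrow> 'a \<Rightarrow> bool) \<Rightarrow> 'a \<Rightarrow> 'a \<Rightarrow> 'a list \<Rightarrow> bool" where
  "maxchain P le x y c \<longleftrightarrow> is_sat_chain P le c \<and> hd c = x \<and> last c = y"

definition label_word :: "('a \<Rightarrow> 'a \<Rightarrow> 'l) \<Rightarrow> 'a list \<Rightarrow> 'l list" where
  "label_word lab c = map (\<lambda>i. lab (c ! i) (c ! Suc i)) [0..<length c - 1]"

definition increasing_word :: "'l::linorder list \<Rightarrow> bool" where
  "increasing_word w \<longleftrightarrow> sorted_wrt (<) w"

definition ER_labeling :: "'a set \<Rightarrow> ('a \<Rightarrow> 'a \<Rightarrow> bool) \<Rightarrow> ('a \<Rightarrow> 'a \<Rightarrow> 'l::linorder) \<Rightarrow> bool" where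
  "ER_labeling P le lab \<longleftrightarrow>
     (\<forall>x\<in>P. \<forall>y\<in>P. le x y \<longrightarrow>
        (\<exists>!c. maxchain P le x y c \<and> increasing_word (label_word lab c)))"

definition rank_two_switching ::
  "'a set \<Rightarrow> ('a \<Rightarrow> 'a \<Rightarrow> bool) \<Rightarrow> 'a \<Rightarrow> ('a \<Rightarrow> 'a \<Rightarrow> 'l::linorder) \<Rightarrow> bool" where
  "rank_two_switching P le b0 lab \<longleftrightarrow>
     (\<forall>c i. is_sat_chain P le c \<and> hd c = b0 \<and> 0 < i \<and> Suc i < length c \<and>
        lab (c ! (i - 1)) (c ! i) < lab (c ! i) (c ! Suc i) \<longrightarrow>
        (\<exists>!x'. covers P le (c ! (i - 1)) x' \<and> covers P le x' (c ! Suc i) \<and>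
               lab (c ! (i - 1)) x' = lab (c ! i) (c ! Suc i) \<and>
               lab x' (c ! Suc i) = lab (c ! (i - 1)) (c ! i)))"

definition EW_labeling ::
  "'a set \<Rightarrow> ('a \<Rightarrow> 'a \<Rightarrow> bool) \<Rightarrow> 'a \<Rightarrow> ('a \<Rightarrow> 'a \<Rightarrow> 'l::linorder) \<Rightarrow> bool" where
  "EW_labeling P le b0 lab \<longleftrightarrow>
     ER_labeling P le lab \<and> rank_two_switching P le b0 lab \<and>
     (\<forall>x y c d. maxchain P le x y c \<and> maxchain P le x y d \<and> c \<noteq> d \<longrightarrow>
        label_word lab c \<noteq> label_word lab d)"

definition sat_chains_from :: "'a set \<Rightarrow> ('a \<Rightarrow> 'a \<Rightarrow> bool) \<Rightarrow> 'a \<Rightarrow> 'a list set" where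
  "sat_chains_from P le b0 = {c. is_sat_chain P le c \<and> hd c = b0}"

definition quad_exchange ::
  "'a set \<Rightarrow> ('a \<Rightarrow> 'a \<Rightarrow> bool) \<Rightarrow> ('a \<Rightarrow> 'a \<Rightarrow> 'l::linorder) \<Rightarrow> 'a list \<Rightarrow> 'a list \<Rightarrow> bool" where
  "quad_exchange P le lab c d \<longleftrightarrow>
     (\<exists>i x'. 0 < i \<and> Suc i < length c \<and>
        lab (c ! (i - 1)) (c ! i) < lab (c ! i) (c ! Suc i) \<and>
        covers P le (c ! (i - 1)) x' \<and> covers P le x' (c ! Suc i) \<and>
        lab (c ! (i - 1)) x' = lab (c ! i) (c ! Suc i) \<and>
        lab x' (c ! Suc i) = lab (c ! (i - 1)) (c ! i) \<and>
        d = c[i := x'])"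

definition chain_equiv ::
  "'a set \<Rightarrow> ('a \<Rightarrow> 'a \<Rightarrow> bool) \<Rightarrow> 'a \<Rightarrow> ('a \<Rightarrow> 'a \<Rightarrow> 'l::linorder) \<Rightarrow> 'a list \<Rightarrow> 'a list \<Rightarrow> bool" where
  "chain_equiv P le b0 lab c1 c2 \<longleftrightarrow>
     c1 \<in> sat_chains_from P le b0 \<and> c2 \<in> sat_chains_from P le b0 \<and>
     last c1 = last c2 \<and> (symclp (quad_exchange P le lab))\<^sup>*\<^sup>* c1 c2"

definition Q_carrier ::
  "'a set \<Rightarrow> ('a \<Rightarrow> 'a \<Rightarrow> bool) \<Rightarrow> 'a \<Rightarrow> ('a \<Rightarrow> 'a \<Rightarrow> 'l::linorder) \<Rightarrow> 'a list set set" where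
  "Q_carrier P le b0 lab =
     (\<lambda>c. {d. chain_equiv P le b0 lab c d}) ` sat_chains_from P le b0"

definition Q_le ::
  "'a set \<Rightarrow> ('a \<Rightarrow> 'a \<Rightarrow> bool) \<Rightarrow> 'a \<Rightarrow> ('a \<Rightarrow> 'a \<Rightarrow> 'l::linorder) \<Rightarrow> 'a list set \<Rightarrow> 'a list set \<Rightarrow> bool" where
  "Q_le P le b0 lab X Y \<longleftrightarrow>
     X \<in> Q_carrier P le b0 lab \<and> Y \<in> Q_carrier P le b0 lab \<and>
     (\<lambda>A B. A \<in> Q_carrier P le b0 lab \<and> B \<in> Q_carrier P le b0 lab \<and>
            (\<exists>c\<in>A. \<exists>d\<in>B. set c \<subseteq> set d))\<^sup>*\<^sup>* X Y"

definition Q_bot ::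
  "'a set \<Rightarrow> ('a \<Rightarrow> 'a \<Rightarrow> bool) \<Rightarrow> 'a \<Rightarrow> ('a \<Rightarrow> 'a \<Rightarrow> 'l::linorder) \<Rightarrow> 'a list set" where
  "Q_bot P le b0 lab = {d. chain_equiv P le b0 lab [b0] d}"

text \<open>Moebius function by its defining recursion
  mu(x,x) = 1, mu(x,y) = - sum over x <= z < y of mu(x,z), mu(x,y) = 0 if not x <= y.
  The recursion is unfolded with a fuel parameter; fuel card P suffices for a finite poset.\<close>
fun mobius_fuel :: "nat \<Rightarrow> 'a set \<Rightarrow> ('a \<Rightarrow> 'a \<Rightarrow> bool) \<Rightarrow> 'a \<Rightarrow> 'a \<Rightarrow> int" where
  "mobius_fuel 0 P le x y = (if x = y then 1 else 0)"
| "mobius_fuel (Suc f) P le x y =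
     (if x = y then 1
      else if le x y then - (\<Sum>z\<in>{z\<in>P. le x z \<and> le z y \<and> z \<noteq> y}. mobius_fuel f P le x z)
      else 0)"

definition mobius :: "'a set \<Rightarrow> ('a \<Rightarrow> 'a \<Rightarrow> bool) \<Rightarrow> 'a \<Rightarrow> 'a \<Rightarrow> int" where
  "mobius P le x y = mobius_fuel (card P) P le x y"

definition graded_with_bottom :: "'a set \<Rightarrow> ('a \<Rightarrow> 'a \<Rightarrow> bool) \<Rightarrow> 'a \<Rightarrow> bool" where
  "graded_with_bottom P le b0 \<longleftrightarrow> finite P \<and> is_poset P le \<and> b0 \<in> P \<and> (\<forall>x\<in>P. le b0 x) \<and>
     (\<forall>x\<in>P. \<forall>c d. maxchain P le b0 x c \<and> maxchain P le b0 x d \<longrightarrow> length c = length d)"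

definition poset_rank :: "'a set \<Rightarrow> ('a \<Rightarrow> 'a \<Rightarrow> bool) \<Rightarrow> 'a \<Rightarrow> 'a \<Rightarrow> nat" where
  "poset_rank P le b0 x = Max {length c - 1 | c. maxchain P le b0 x c}"

definition whitney_first :: "'a set \<Rightarrow> ('a \<Rightarrow> 'a \<Rightarrow> bool) \<Rightarrow> 'a \<Rightarrow> nat \<Rightarrow> int" where
  "whitney_first P le b0 k = (\<Sum>x\<in>{x\<in>P. poset_rank P le b0 x = k}. mobius P le b0 x)"

definition whitney_second :: "'a set \<Rightarrow> ('a \<Rightarrow> 'a \<Rightarrow> bool) \<Rightarrow> 'a \<Rightarrow> nat \<Rightarrow> nat" where
  "whitney_second P le b0 k = card {x\<in>P. poset_rank P le b0 x = k}"

definition whitney_duals ::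
  "'a set \<Rightarrow> ('a \<Rightarrow> 'a \<Rightarrow> bool) \<Rightarrow> 'a \<Rightarrow> 'b set \<Rightarrow> ('b \<Rightarrow> 'b \<Rightarrow> bool) \<Rightarrow> 'b \<Rightarrow> bool" where
  "whitney_duals P leP botP Q leQ botQ \<longleftrightarrow>
     graded_with_bottom P leP botP \<and> graded_with_bottom Q leQ botQ \<and>
     (\<forall>k. \<bar>whitney_first P leP botP k\<bar> = int (whitney_second Q leQ botQ k) \<and>
          \<bar>whitney_first Q leQ botQ k\<bar> = int (whitney_second P leP botP k))"

definition noncrossing :: "nat set set \<Rightarrow> bool" where
  "noncrossing \<pi> \<longleftrightarrow> \<not> (\<exists>B\<in>\<pi>. \<exists>B'\<in>\<pi>. B \<noteq> B' \<and>
       (\<exists>a b c d. a < b \<and> b < c \<and> c < d \<and> a \<in> B \<and> c \<in> B \<and> b \<in> B' \<and> d \<in> B'))"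

definition NC :: "nat \<Rightarrow> nat set set set" where
  "NC n = {\<pi>. partition_on {1..n} \<pi> \<and> noncrossing \<pi>}"

definition refines :: "nat set set \<Rightarrow> nat set set \<Rightarrow> bool" where
  "refines \<pi> \<sigma> \<longleftrightarrow> (\<forall>B\<in>\<pi>. \<exists>C\<in>\<sigma>. B \<subseteq> C)"

definition NC_bot :: "nat \<Rightarrow> nat set set" where
  "NC_bot n = (\<lambda>i. {i}) ` {1..n}"

text \<open>For a cover merging blocks B_i, B_j of pi (the two blocks of pi not in sigma)
  with min B_i < min B_j, the label is max of the elements of B_i below min B_j.\<close>
definition nc_label :: "nat set set \<Rightarrow> nat set set \<Rightarrow> nat" where
  "nc_label \<pi> \<sigma> =
     (let Bj = (THE B. B \<in> \<pi> - \<sigma> \<and> Min B = Max (Min ` (\<pi> - \<sigma>)));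
          Bi = (THE B. B \<in> \<pi> - \<sigma> \<and> B \<noteq> Bj)
      in Max {a\<in>Bi. a < Min Bj})"

end

(*
Two noncrossing blocks D, E with min D < min E are separated in the following sense: with
a = max {d : D | d < min E}, every d > a in D lies above all of E.  Thus a cover with label a merges
two blocks such that "hooks D E a" below holds.

Increasing chains: the label set of an increasing chain from x to y is forced to be the set of
predecessors, within the blocks of y, of the minima of those x-blocks that do not start a y-block;
a chain is found by repeatedly splitting off from y the x-block with the largest such predecessor.
A chain is recovered from its word from the top: the last label b tells which block C of y
was merged last and that the part E was a segment of C following b; the number of labels
lying in E, which is one less than the number of x-blocks in E, determines where E ends.

Whitney duality for any EW-labeling: each quadratic exchange preserves the multiset of labels, and
exchanges at ascents lead to the unique chain with weakly decreasing word, so an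
element of Q is a pair of a top element and a multiset of labels.  Saturated chains of Q from the
bottom therefore correspond to those of P, and each interval of Q has a unique weakly decreasing
maximal chain.  The usual sign-reversing argument computes the Moebius functions of P and
Q, with the roles of increasing and weakly decreasing chains exchanged.
*)
theory Submission
  imports Defs "HOL-Library.Multiset"
begin

section \<open>Saturated chains and the Moebius function\<close>

lemma is_sat_chain_iff:
  "is_sat_chain P le c \<longleftrightarrow> c \<noteq> [] \<and> set c \<subseteq> P \<and> successively (covers P le) c"
  by (auto simp: is_sat_chain_def successively_conv_nth)

text \<open>The two pieces share the element \<open>last c\<close>, so that the cover across the
  junction is kept. Label words are cut in the same way.\<close>

lemma is_sat_chain_append:
  assumes "c \<noteq> []"
  shows "is_sat_chain P le (c @ d) \<longleftrightarrow> is_sat_chain P le c \<and> is_sat_chain P le (last c # d)"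
  using assms last_in_set[OF assms]
  by (cases d) (auto simp: is_sat_chain_iff successively_append_iff)

lemma covers_in: "covers P le x y \<Longrightarrow> x \<in> P \<and> y \<in> P \<and> le x y \<and> x \<noteq> y"
  by (simp add: covers_def)

lemma is_sat_chain_Cons [simp]:
  "is_sat_chain P le [x] \<longleftrightarrow> x \<in> P"
  "is_sat_chain P le (x # y # c) \<longleftrightarrow> covers P le x y \<and> is_sat_chain P le (y # c)"
  by (auto simp: is_sat_chain_iff dest: covers_in)

lemma is_sat_chain_snoc:
  "c \<noteq> [] \<Longrightarrow> is_sat_chain P le (c @ [y]) \<longleftrightarrow> is_sat_chain P le c \<and> covers P le (last c) y"
  by (auto simp: is_sat_chain_append dest: covers_in)

lemma is_sat_chain_nonempty: "is_sat_chain P le c \<Longrightarrow> c \<noteq> []"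
  by (simp add: is_sat_chain_def)

lemma is_sat_chain_take:
  "is_sat_chain P le c \<Longrightarrow> is_sat_chain P le (take (Suc i) c)"
  by (metis append_take_drop_id is_sat_chain_append is_sat_chain_nonempty take_eq_Nil2 nat.distinct(1))

lemma is_sat_chain_drop:
  assumes "is_sat_chain P le c" "i < length c"
  shows "is_sat_chain P le (drop i c)"
proof -
  have "take (Suc i) c @ drop (Suc i) c = c" "take (Suc i) c \<noteq> []" "last (take (Suc i) c) = c ! i"
    using assms by (simp_all add: take_Suc_conv_app_nth Cons_nth_drop_Suc)
  then show ?thesis
    using assms is_sat_chain_append[of "take (Suc i) c" P le "drop (Suc i) c"]
    by (simp add: Cons_nth_drop_Suc)
qed

lemma label_word_simps [simp]:
  "label_word lab [] = []"
  "label_word lab [x] = []"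
  "label_word lab (x # y # c) = lab x y # label_word lab (y # c)"
proof -
  have "[0..<Suc (length c)] = 0 # map Suc [0..<length c]"
    by (metis map_Suc_upt upt_conv_Cons zero_less_Suc)
  then show "label_word lab (x # y # c) = lab x y # label_word lab (y # c)"
    unfolding label_word_def by (simp del: upt_Suc)
qed (simp_all add: label_word_def)

lemma length_label_word [simp]: "length (label_word lab c) = length c - 1"
  by (simp add: label_word_def)

lemma label_word_append:
  "c \<noteq> [] \<Longrightarrow> label_word lab (c @ d) = label_word lab c @ label_word lab (last c # d)"
  by (induction c rule: induct_list012) auto

lemma label_word_split:
  assumes "i < length c"
  shows "label_word lab (take (Suc i) c) = take i (label_word lab c)"
    and "label_word lab (drop i c) = drop i (label_word lab c)"
proof -
  have eq: "take (Suc i) c @ drop (Suc i) c = c" "take (Suc i) c \<noteq> []" "last (take (Suc i) c) = c ! i"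
    using assms by (simp_all add: take_Suc_conv_app_nth Cons_nth_drop_Suc)
  then have "label_word lab c = label_word lab (take (Suc i) c) @ label_word lab (drop i c)"
    using label_word_append[OF eq(2), of lab "drop (Suc i) c"] assms by (simp add: Cons_nth_drop_Suc)
  moreover have "length (label_word lab (take (Suc i) c)) = i" using assms by simp
  ultimately show "label_word lab (take (Suc i) c) = take i (label_word lab c)"
    "label_word lab (drop i c) = drop i (label_word lab c)" by simp_all
qed

lemma nth_label_word: "Suc i < length c \<Longrightarrow> label_word lab c ! i = lab (c ! i) (c ! Suc i)"
  by (simp add: label_word_def nth_upt less_diff_conv)

lemma increasing_word_iff: "increasing_word w \<longleftrightarrow> successively (<) w"
  by (simp add: increasing_word_def successively_conv_sorted_wrt)

text \<open>The admissible pivots i of a nonempty word, if any, are two neighbouring positions.\<close>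
lemma sum_pivots_eq_0:
  assumes "w \<noteq> []"
  shows "(\<Sum>i\<le>length w. if successively (\<lambda>a b. \<not> R a b) (take i w) \<and> successively R (drop i w)
            then (-1) ^ i else (0::int)) = 0"
  using assms
proof (induction w rule: induct_list012)
  case (3 a b w)
  show ?case
  proof (cases "R a b")
    case True
    \<comment> \<open>With \<open>R a b\<close> only the pivots 0 and 1 can be admissible, both
      exactly when \<open>b # w\<close> is an \<open>R\<close>-word, and their signs cancel.\<close>
    then show ?thesis
      by (simp add: sum.atMost_Suc_shift del: sum.atMost_Suc)
  next
    case False
    \<comment> \<open>Without \<open>R a b\<close> the pivot 0 fails, and the others are the pivots
      of \<open>b # w\<close> shifted by one, which flips every sign.\<close>
    have eq: "take (Suc i) (a # b # w) = a # take i (b # w)" 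
      "successively (\<lambda>a b. \<not> R a b) (a # take i (b # w)) = successively (\<lambda>a b. \<not> R a b) (take i (b # w))" for i
      using False by (cases i; simp)+
    have "(\<Sum>i\<le>length (b # w). if successively (\<lambda>a b. \<not> R a b) (take (Suc i) (a # b # w))
            \<and> successively R (drop (Suc i) (a # b # w)) then (-1) ^ (Suc i) else (0::int)) =
          - (\<Sum>i\<le>length (b # w). if successively (\<lambda>a b. \<not> R a b) (take i (b # w))
            \<and> successively R (drop i (b # w)) then (-1) ^ i else (0::int))"
      unfolding eq sum_negf[symmetric] by (intro sum.cong) auto
    also have "\<dots> = 0" using 3 by simp
    finally show ?thesis using False
      by (simp only: list.size(4) add_Suc_right add_0_right sum.atMost_Suc_shift) simp
  qed
qed simp_all

section \<open>Graded posets with a bottom element\<close>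

locale graded_poset =
  fixes P :: "'a set" and le :: "'a \<Rightarrow> 'a \<Rightarrow> bool" and b0 :: 'a
  assumes graded: "graded_with_bottom P le b0"
begin

lemma finite_P: "finite P" and bot_in: "b0 \<in> P" and bot_le: "x \<in> P \<Longrightarrow> le b0 x"
  and po_refl: "x \<in> P \<Longrightarrow> le x x"
  and po_antisym: "\<lbrakk>x \<in> P; y \<in> P; le x y; le y x\<rbrakk> \<Longrightarrow> x = y"
  and po_trans: "\<lbrakk>x \<in> P; y \<in> P; z \<in> P; le x y; le y z\<rbrakk> \<Longrightarrow> le x z"
  and same_length: "\<lbrakk>x \<in> P; maxchain P le b0 x c; maxchain P le b0 x d\<rbrakk> \<Longrightarrow> length c = length d"
  using graded unfolding graded_with_bottom_def is_poset_def by blast+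

lemma chain_less:
  assumes "is_sat_chain P le (x # c)" "y \<in> set c"
  shows "le x y \<and> x \<noteq> y"
  using assms
proof (induction c arbitrary: x)
  case (Cons z c)
  then have z: "x \<in> P" "z \<in> P" "le x z" "x \<noteq> z" by (auto dest: covers_in)
  show ?case
  proof (cases "y = z")
    case False
    have "le z y \<and> z \<noteq> y" and "y \<in> P"
      using Cons False by (auto simp: is_sat_chain_iff)
    then show ?thesis using z po_trans po_antisym by blast
  qed (use z in simp)
qed simp

lemma chain_distinct: "is_sat_chain P le c \<Longrightarrow> distinct c"
proof (induction c)
  case (Cons x c)
  then show ?case using chain_less[of x c] by (cases c) auto
qed simp

lemma chain_length_le: "is_sat_chain P le c \<Longrightarrow> length c \<le> card P"
  using chain_distinct[of c] finite_P by (metis distinct_card card_mono is_sat_chain_def)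

lemma finite_chains: "finite {c. is_sat_chain P le c \<and> Q c}"
  by (rule finite_subset[OF _ finite_lists_length_le[OF finite_P, of "card P"]])
    (auto simp: chain_length_le is_sat_chain_def)

lemma finite_maxchains: "finite {c. maxchain P le x y c \<and> Q c}"
  unfolding maxchain_def conj_assoc by (rule finite_chains)

lemma maxchain_in: "maxchain P le x y c \<Longrightarrow> x \<in> P \<and> y \<in> P \<and> c \<noteq> []"
  unfolding maxchain_def is_sat_chain_def by (metis hd_in_set last_in_set subsetD)

lemma maxchain_refl: "x \<in> P \<Longrightarrow> maxchain P le x x c \<longleftrightarrow> c = [x]"
proof (cases c)
  case (Cons y d)
  assume "x \<in> P"
  then show ?thesis using chain_less[of y d "last d"] Cons by (cases "d = []") (auto simp: maxchain_def)
qed (simp add: maxchain_def is_sat_chain_def)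

lemma maxchain_append:
  assumes "maxchain P le x z c" "maxchain P le z y d"
  shows "maxchain P le x y (c @ tl d)"
proof -
  obtain e where d: "d = z # e"
    using assms(2) maxchain_in[OF assms(2)] by (cases d) (auto simp: maxchain_def)
  then show ?thesis
    using assms maxchain_in[OF assms(1)] is_sat_chain_append[of c P le e]
    by (cases e) (auto simp: maxchain_def)
qed

lemma maxchain_split:
  assumes "maxchain P le x y c" "i < length c"
  shows "maxchain P le x (c ! i) (take (Suc i) c)" "maxchain P le (c ! i) y (drop i c)"
proof -
  have "last (take (Suc i) c) = c ! i" "hd (take (Suc i) c) = hd c"
    using assms(2) by (simp add: take_Suc_conv_app_nth, simp add: hd_take)
  then show "maxchain P le x (c ! i) (take (Suc i) c)"
    using assms is_sat_chain_take[of P le c i] by (simp add: maxchain_def)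
  show "maxchain P le (c ! i) y (drop i c)"
    using assms is_sat_chain_drop[of P le c i] by (simp add: maxchain_def hd_drop_conv_nth)
qed

lemma maxchain_le:
  assumes "maxchain P le x y c"
  shows "le x y"
proof -
  obtain e where c: "c = x # e" 
    using assms maxchain_in[OF assms] by (cases c) (auto simp: maxchain_def)
  show ?thesis
  proof (cases "e = []")
    case False
    then show ?thesis using assms chain_less[of x e y] c by (auto simp: maxchain_def)
  qed (use assms c po_refl[of x] in \<open>auto simp: maxchain_def\<close>)
qed

text \<open>All maximal chains from \<open>b0\<close> to \<open>x\<close> have one length, so the
  maximum in \<open>poset_rank\<close> is taken over a singleton.\<close>

lemma rank_eq:
  assumes "maxchain P le b0 x c"
  shows "poset_rank P le b0 x = length c - 1"
proof -
  have len: "length d = length c" if "maxchain P le b0 x d" for d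
    by (rule same_length[OF _ that assms]) (use maxchain_in[OF assms] in simp)
  have "{length c - 1 | c. maxchain P le b0 x c} = {length c - 1}"
  proof (intro equalityI subsetI)
    fix k assume "k \<in> {length c - 1 | c. maxchain P le b0 x c}"
    then obtain d where "maxchain P le b0 x d" "k = length d - 1" by blast
    then show "k \<in> {length c - 1}" using len[of d] by simp
  qed (use assms in blast)
  then show ?thesis by (simp add: poset_rank_def)
qed

end

section \<open>The Moebius function of a labeled graded poset\<close>

text \<open>The relation R on consecutive labels is strict increase for P and weak decrease for Q.\<close>
locale ER_poset = graded_poset P le b0
  for P :: "'a set" and le :: "'a \<Rightarrow> 'a \<Rightarrow> bool" and b0 :: 'a +
  fixes lab :: "'a \<Rightarrow> 'a \<Rightarrow> 'l" and R :: "'l \<Rightarrow> 'l \<Rightarrow> bool"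
  assumes unique_R_chain:
    "\<lbrakk>x \<in> P; y \<in> P; le x y\<rbrakk> \<Longrightarrow> \<exists>!c. maxchain P le x y c \<and> successively R (label_word lab c)"
begin

abbreviation "rk \<equiv> poset_rank P le b0"

text \<open>With \<open>R\<close> strict increase these are the ascent-free chains; with
  \<open>R\<close> weak decrease they are the strictly increasing ones.\<close>

definition falling :: "'a \<Rightarrow> 'a list set" where
  "falling y = {c. maxchain P le b0 y c \<and> successively (\<lambda>a b. \<not> R a b) (label_word lab c)}"

definition rising :: "'a \<Rightarrow> 'a \<Rightarrow> 'a list" where
  "rising x y = (THE c. maxchain P le x y c \<and> successively R (label_word lab c))"

lemma rising:
  assumes "x \<in> P" "y \<in> P" "le x y"
  shows "maxchain P le x y (rising x y)" "successively R (label_word lab (rising x y))"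
  using theI'[OF unique_R_chain[OF assms]] unfolding rising_def by blast+

lemma rising_eqI:
  "maxchain P le x y c \<Longrightarrow> successively R (label_word lab c) \<Longrightarrow> rising x y = c"
  using unique_R_chain[of x y] rising[of x y] maxchain_in[of x y c] maxchain_le[of x y c] by blast

text \<open>The labeling supplies a maximal chain from \<open>x\<close> to \<open>y\<close>, which
  properly prolongs a chain from \<open>b0\<close> to \<open>x\<close>.\<close>

lemma rank_less:
  assumes "x \<in> P" "y \<in> P" "le x y" "x \<noteq> y"
  shows "rk x < rk y"
proof -
  obtain c d where c: "maxchain P le b0 x c" and d: "maxchain P le x y d"
    using rising assms bot_in bot_le by meson
  have "length d > 1"
    using d assms(4) by (cases d rule: list.exhaust; cases "tl d") (auto simp: maxchain_def is_sat_chain_def)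
  then show ?thesis
    using rank_eq[OF c] rank_eq[OF maxchain_append[OF c d]] maxchain_in[OF c] by (cases c) auto
qed

lemma finite_falling: "finite (falling y)"
  unfolding falling_def by (rule finite_maxchains)

text \<open>This is the Moebius recursion for the signed count of falling chains. A falling chain up
  to \<open>z\<close> followed by the rising chain from \<open>z\<close> to \<open>y\<close> is a
  maximal chain of \<open>[b0, y]\<close> with an admissible pivot at \<open>z\<close>. Regrouped by
  maximal chains, the sum becomes a sum over the pivots of single words, and these vanish.\<close>

lemma sum_falling_eq_0:
  assumes y: "y \<in> P" "y \<noteq> b0"
  shows "(\<Sum>z\<in>{z\<in>P. le z y}. (-1) ^ rk z * int (card (falling z))) = 0"
proof -
  let ?Z = "{z\<in>P. le z y}"
  let ?T = "{C. maxchain P le b0 y C}"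
  let ?V = "\<lambda>C. {i. i \<le> length (label_word lab C) \<and> successively (\<lambda>a b. \<not> R a b) (take i (label_word lab C))
                 \<and> successively R (drop i (label_word lab C))}"
  have fin: "finite ?Z" "finite ?T"
    using finite_P finite_maxchains[of b0 y "\<lambda>_. True"] by auto
  have "(\<Sum>z\<in>?Z. (-1) ^ rk z * int (card (falling z))) = (\<Sum>z\<in>?Z. \<Sum>c\<in>falling z. (-1) ^ (length c - 1))"
  proof (intro sum.cong refl)
    fix z
    have "(\<Sum>c\<in>falling z. (-1) ^ (length c - 1)) = (\<Sum>c\<in>falling z. (-1) ^ rk z :: int)"
      by (intro sum.cong) (auto simp: falling_def rank_eq)
    then show "(-1) ^ rk z * int (card (falling z)) = (\<Sum>c\<in>falling z. (-1) ^ (length c - 1))"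
      by simp
  qed
  also have "\<dots> = (\<Sum>(z, c)\<in>Sigma ?Z falling. (-1) ^ (length c - 1))"
    using fin by (simp add: sum.Sigma finite_falling)
  also have "\<dots> = (\<Sum>(C, i)\<in>Sigma ?T ?V. (-1) ^ i)"
  \<comment> \<open>The pivot is the number of covers in the falling part; \<open>tl\<close> drops
    the shared element \<open>z\<close>.\<close>
  proof (rule sum.reindex_bij_witness[where i = "\<lambda>(C, i). (C ! i, take (Suc i) C)"
        and j = "\<lambda>(z, c). (c @ tl (rising z y), length c - 1)"])
    fix a assume "a \<in> Sigma ?Z falling"
    then obtain z c where a: "a = (z, c)" and z: "z \<in> P" "le z y" and c: "c \<in> falling z"
      by auto
    note r = rising[OF z(1) y(1) z(2)]
    have mc: "maxchain P le b0 z c" using c by (simp add: falling_def)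
    then have ne: "c \<noteq> []" "last c = z" using maxchain_in[OF mc] by (auto simp: maxchain_def)
    have "rising z y = z # tl (rising z y)"
      using r maxchain_in[OF r(1)] by (metis maxchain_def list.collapse)
    then have lw: "label_word lab (c @ tl (rising z y)) = label_word lab c @ label_word lab (rising z y)"
      using ne by (simp add: label_word_append)
    have "c ! (length c - 1) = z" using ne by (simp add: last_conv_nth)
    with ne show "(case case a of (z, c) \<Rightarrow> (c @ tl (rising z y), length c - 1) of
        (C, i) \<Rightarrow> (C ! i, take (Suc i) C)) = a"
      by (simp add: a nth_append)
    show "(case a of (z, c) \<Rightarrow> (c @ tl (rising z y), length c - 1)) \<in> Sigma ?T ?V"
      using maxchain_append[OF mc r(1)] r(2) c lw by (simp add: a falling_def)
    show "(case case a of (z, c) \<Rightarrow> (c @ tl (rising z y), length c - 1) of (C, i) \<Rightarrow> (-1) ^ i)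
        = (case a of (z, c) \<Rightarrow> (-1) ^ (length c - 1))"
      by (simp add: a)
  next
    fix b assume "b \<in> Sigma ?T ?V"
    then obtain C i where b: "b = (C, i)" and C: "maxchain P le b0 y C" and i: "i \<in> ?V C"
      by auto
    have len: "i < length C" using i maxchain_in[OF C] by (cases C) auto
    note sp = maxchain_split[OF C len]
    \<comment> \<open>Uniqueness of the \<open>R\<close>-chain makes the part above the pivot the
      chosen rising chain, so the pair can be recovered.\<close>
    have r: "rising (C ! i) y = drop i C"
      using i sp by (intro rising_eqI) (simp_all add: label_word_split len)
    have tl: "tl (drop i C) = drop (Suc i) C" by (simp add: drop_Suc tl_drop)
    show "(case case b of (C, i) \<Rightarrow> (C ! i, take (Suc i) C) of
        (z, c) \<Rightarrow> (c @ tl (rising z y), length c - 1)) = b"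
      using len by (simp add: b r tl)
    show "(case b of (C, i) \<Rightarrow> (C ! i, take (Suc i) C)) \<in> Sigma ?Z falling"
      using i sp maxchain_in[OF sp(2)] maxchain_le[OF sp(2)]
      by (simp add: b falling_def label_word_split len)
  qed
  also have "\<dots> = (\<Sum>C\<in>?T. \<Sum>i\<in>?V C. (-1) ^ i)"
    using fin by (subst sum.Sigma) auto
  also have "\<dots> = 0"
  proof (rule sum.neutral, rule ballI)
    fix C assume C: "C \<in> ?T"
    \<comment> \<open>A maximal chain from \<open>b0\<close> to another element has at least one
      cover, hence a nonempty word, whose pivots cancel.\<close>
    have "length C \<noteq> 1" using C y(2) by (cases C) (auto simp: maxchain_def)
    then have "label_word lab C \<noteq> []" 
      using C maxchain_in[of b0 y C] by (cases C; cases "tl C") auto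
    from sum_pivots_eq_0[OF this, of R] show "(\<Sum>i\<in>?V C. (-1) ^ i) = (0::int)"
      by (subst (asm) sum.inter_filter[symmetric]) simp_all
  qed
  finally show ?thesis .
qed

lemma falling_bot: "falling b0 = {[b0]}"
  by (auto simp: falling_def maxchain_refl bot_in)

text \<open>Induction on the fuel with invariant \<open>rk y \<le> f\<close>: recursive calls go to
  strictly smaller rank, so the fuel does not run out before \<open>b0\<close>, and
  \<open>card P\<close> bounds every rank.\<close>

theorem mobius_eq:
  assumes "y \<in> P"
  shows "mobius P le b0 y = (-1) ^ rk y * int (card (falling y))"
proof -
  have rk_bot: "rk b0 = 0" using rank_eq[of b0 "[b0]"] maxchain_refl[OF bot_in] by simp
  have "mobius_fuel f P le b0 y = (-1) ^ rk y * int (card (falling y))" if "y \<in> P" "rk y \<le> f" for f y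
    using that
  proof (induction f arbitrary: y)
    case 0
    then have "y = b0" using rank_less[OF bot_in _ bot_le] by fastforce
    then show ?case by (simp add: falling_bot rk_bot)
  next
    case (Suc f)
    show ?case
    proof (cases "y = b0")
      case True
      then show ?thesis by (simp add: falling_bot rk_bot)
    next
      case False
      have "(\<Sum>z\<in>{z\<in>P. le b0 z \<and> le z y \<and> z \<noteq> y}. mobius_fuel f P le b0 z)
          = (\<Sum>z\<in>{z\<in>P. le z y} - {y}. (-1) ^ rk z * int (card (falling z)))"
      proof (rule sum.cong)
        fix z assume "z \<in> {z\<in>P. le z y} - {y}"
        then show "mobius_fuel f P le b0 z = (-1) ^ rk z * int (card (falling z))"
          using Suc rank_less[of z y] by auto
      qed (auto simp: bot_le)
      also have "\<dots> = - ((-1) ^ rk y * int (card (falling y)))"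
        using sum_falling_eq_0[OF Suc.prems(1) False] finite_P Suc.prems(1) po_refl[of y]
        by (simp add: sum_diff1)
      finally show ?thesis using False bot_le[OF Suc.prems(1)] by simp
    qed
  qed
  moreover have "rk y \<le> card P"
  proof -
    note r = rising(1)[OF bot_in assms bot_le[OF assms]]
    show ?thesis using rank_eq[OF r] chain_length_le[of "rising b0 y"] r by (simp add: maxchain_def)
  qed
  ultimately show ?thesis using assms by (simp add: mobius_def)
qed

text \<open>All elements of rank \<open>k\<close> contribute with the same sign
  \<open>(-1) ^ k\<close>, so the absolute value is a plain count of falling chains with
  \<open>k\<close> covers.\<close>

lemma whitney_first_abs:
  "\<bar>whitney_first P le b0 k\<bar> = int (card {c. c \<in> sat_chains_from P le b0 \<and> length c = Suc k \<and>
      successively (\<lambda>a b. \<not> R a b) (label_word lab c)})"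
proof -
  let ?X = "{x\<in>P. rk x = k}"
  have "{c. c \<in> sat_chains_from P le b0 \<and> length c = Suc k \<and>
      successively (\<lambda>a b. \<not> R a b) (label_word lab c)} = (\<Union>x\<in>?X. falling x)"
    (is "?L = _")
  proof (intro equalityI subsetI)
    fix c assume "c \<in> ?L"
    then have "maxchain P le b0 (last c) c" "length c = Suc k" 
      "successively (\<lambda>a b. \<not> R a b) (label_word lab c)"
      by (auto simp: sat_chains_from_def maxchain_def)
    then show "c \<in> (\<Union>x\<in>?X. falling x)"
      using rank_eq maxchain_in by (fastforce simp: falling_def)
  next
    fix c assume "c \<in> (\<Union>x\<in>?X. falling x)"
    then obtain x where x: "rk x = k" "maxchain P le b0 x c"
      "successively (\<lambda>a b. \<not> R a b) (label_word lab c)" by (auto simp: falling_def)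
    then have "length c = Suc k" using rank_eq[OF x(2)] maxchain_in[OF x(2)] by (cases c) auto
    then show "c \<in> ?L" using x by (auto simp: sat_chains_from_def maxchain_def)
  qed
  moreover have "card (\<Union>x\<in>?X. falling x) = (\<Sum>x\<in>?X. card (falling x))"
    by (rule card_UN_disjoint) (auto simp: finite_P finite_falling, auto simp: falling_def maxchain_def)
  moreover have "whitney_first P le b0 k = (-1) ^ k * int (\<Sum>x\<in>?X. card (falling x))"
    unfolding whitney_first_def using mobius_eq by (simp add: sum_distrib_left)
  ultimately show ?thesis by (simp add: abs_mult power_abs sum_nonneg)
qed

end

section \<open>Whitney duals from EW-labelings\<close>

text \<open>The termination measure for sorting a word into weakly decreasing order.\<close>

fun noninversions :: "'l::linorder list \<Rightarrow> nat" where
  "noninversions [] = 0"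
| "noninversions (x # xs) = length (filter ((<) x) xs) + noninversions xs"

lemma noninversions_swap:
  "a < b \<Longrightarrow> noninversions (us @ b # a # vs) < noninversions (us @ a # b # vs)"
  by (induction us) auto

lemma not_successively_less_iff:
  "successively (\<lambda>a b. \<not> a < b) w \<longleftrightarrow> sorted (rev w)" for w :: "'l::linorder list"
proof -
  have "transp (\<lambda>a b::'l. b \<le> a)" by (auto intro: transpI)
  from successively_conv_sorted_wrt[OF this, of w] show ?thesis
    by (simp add: not_less sorted_wrt_rev)
qed

lemma descending_unique:
  fixes w w' :: "'l::linorder list"
  assumes "successively (\<lambda>a b. \<not> a < b) w" "successively (\<lambda>a b. \<not> a < b) w'" "mset w = mset w'"
  shows "w = w'"
proof -
  have "sorted (rev w)" "sorted (rev w')" "mset (rev w) = mset (rev w')"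
    using assms by (simp_all add: not_successively_less_iff)
  then have "rev w = rev w'" by (metis properties_for_sort)
  then show ?thesis by simp
qed

lemma label_word_mid:
  "label_word lab (p @ x # y # z # q) = label_word lab (p @ [x]) @ lab x y # lab y z # label_word lab (z # q)"
  using label_word_append[of "p @ [x]" lab "y # z # q"] by simp

lemma take_nth3_drop:
  "Suc (Suc i) < length l \<Longrightarrow>
    take i l @ l ! i # l ! Suc i # l ! Suc (Suc i) # drop (Suc (Suc (Suc i))) l = l"
  by (simp add: Cons_nth_drop_Suc)

text \<open>Splitting the list around the exchanged element replaces the indices of the definition,
  so that the words of both chains can be compared piece by piece.\<close>

lemma quad_exchange_iff:
  "quad_exchange P le lab c d \<longleftrightarrow> (\<exists>p x y y' z q. c = p @ x # y # z # q \<and> d = p @ x # y' # z # q \<and>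
     lab x y < lab y z \<and> covers P le x y' \<and> covers P le y' z \<and> lab x y' = lab y z \<and> lab y' z = lab x y)"
  (is "_ \<longleftrightarrow> ?R")
proof
  assume "quad_exchange P le lab c d"
  then obtain i y' where i: "0 < i" "Suc i < length c" and
    h: "lab (c ! (i - 1)) (c ! i) < lab (c ! i) (c ! Suc i)"
     "covers P le (c ! (i - 1)) y'" "covers P le y' (c ! Suc i)"
     "lab (c ! (i - 1)) y' = lab (c ! i) (c ! Suc i)" "lab y' (c ! Suc i) = lab (c ! (i - 1)) (c ! i)"
    and d: "d = c[i := y']" unfolding quad_exchange_def by blast
  obtain j where j: "i = Suc j" using i(1) by (cases i) auto
  have c: "c = take j c @ c ! j # c ! Suc j # c ! Suc (Suc j) # drop (Suc (Suc (Suc j))) c"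
    using i j by (simp add: Cons_nth_drop_Suc)
  have "d = take j c @ c ! j # y' # c ! Suc (Suc j) # drop (Suc (Suc (Suc j))) c"
    unfolding d j using i j by (subst c) (simp add: list_update_append)
  with c h show ?R unfolding j by (metis diff_Suc_1)
next
  assume ?R
  then obtain p x y y' z q where "c = p @ x # y # z # q" "d = p @ x # y' # z # q"
     "lab x y < lab y z" "covers P le x y'" "covers P le y' z" "lab x y' = lab y z" "lab y' z = lab x y"
    by blast
  then show "quad_exchange P le lab c d"
    unfolding quad_exchange_def
    by (intro exI[of _ "Suc (length p)"] exI[of _ y']) (simp add: nth_append list_update_append)
qed

text \<open>A backward exchange may insert an arbitrary element, so intermediate lists need not be chains.\<close>
lemma quad_exchange_invariants:
  assumes "(symclp (quad_exchange P le lab))\<^sup>*\<^sup>* c d"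
  shows "mset (label_word lab d) = mset (label_word lab c)"
  using assms
proof (induction rule: rtranclp_induct)
  case (step c' d)
  then show ?case
    by (auto simp: symclp_def quad_exchange_iff label_word_mid add_mset_commute)
qed simp

section \<open>Sorting chains and the exchange classes\<close>

locale EW_poset = graded_poset P le b0
  for P :: "'a set" and le :: "'a \<Rightarrow> 'a \<Rightarrow> bool" and b0 :: 'a +
  fixes lab :: "'a \<Rightarrow> 'a \<Rightarrow> 'l::linorder"
  assumes EW: "EW_labeling P le b0 lab"
begin

sublocale ER_poset P le b0 lab "(<)"
  by unfold_locales
    (use EW in \<open>simp add: EW_labeling_def ER_labeling_def increasing_word_iff\<close>)

abbreviation "CH \<equiv> sat_chains_from P le b0"
abbreviation "lw \<equiv> label_word lab"
abbreviation "Q \<equiv> Q_carrier P le b0 lab"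
abbreviation "Qle \<equiv> Q_le P le b0 lab"

lemma words_inj:
  "\<lbrakk>maxchain P le x y c; maxchain P le x y d; lw c = lw d\<rbrakk> \<Longrightarrow> c = d"
  using EW unfolding EW_labeling_def by blast

lemma CH_maxchain: "c \<in> CH \<Longrightarrow> maxchain P le b0 (last c) c"
  by (simp add: sat_chains_from_def maxchain_def)

lemma CH_nonempty: "c \<in> CH \<Longrightarrow> c \<noteq> []"
  by (simp add: sat_chains_from_def is_sat_chain_def)

lemma CH_append:
  "c \<noteq> [] \<Longrightarrow> c @ e \<in> CH \<longleftrightarrow> c \<in> CH \<and> is_sat_chain P le (last c # e)"
  by (auto simp: sat_chains_from_def is_sat_chain_append)

lemma bot_CH: "[b0] \<in> CH"
  by (simp add: sat_chains_from_def bot_in)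

lemma CH_tl: "c \<in> CH \<Longrightarrow> [b0] @ tl c = c"
  using CH_nonempty by (cases c) (auto simp: sat_chains_from_def)

lemma switch:
  assumes "p @ x # y # z # q \<in> CH" "lab x y < lab y z"
  shows "\<exists>y'. quad_exchange P le lab (p @ x # y # z # q) (p @ x # y' # z # q) \<and>
    lab x y' = lab y z \<and> lab y' z = lab x y"
proof -
  let ?c = "p @ x # y # z # q" and ?i = "Suc (length p)"
  have "\<exists>x'. covers P le (?c ! (?i - 1)) x' \<and> covers P le x' (?c ! Suc ?i) \<and>
               lab (?c ! (?i - 1)) x' = lab (?c ! ?i) (?c ! Suc ?i) \<and>
               lab x' (?c ! Suc ?i) = lab (?c ! (?i - 1)) (?c ! ?i)"
    using EW assms unfolding EW_labeling_def rank_two_switching_def sat_chains_from_def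
    by (elim conjE allE[of _ ?c] allE[of _ ?i]) (auto simp: nth_append)
  then show ?thesis
    using assms(2) unfolding quad_exchange_iff by (fastforce simp: nth_append)
qed

lemma quad_exchange_CH:
  assumes "quad_exchange P le lab c d" "c \<in> CH"
  shows "d \<in> CH \<and> last d = last c \<and> mset (lw d) = mset (lw c)"
proof -
  obtain p x y y' z q where h: "c = p @ x # y # z # q" "d = p @ x # y' # z # q"
    "covers P le x y'" "covers P le y' z"
    using assms(1) unfolding quad_exchange_iff by blast
  have "d \<in> CH" using assms(2) h CH_append[of "p @ [x]" "y # z # q"] CH_append[of "p @ [x]" "y' # z # q"]
    by simp
  moreover have "mset (lw d) = mset (lw c)"
    using assms(1) by (intro quad_exchange_invariants[of P le]) (auto simp: symclp_def)
  ultimately show ?thesis using h by simp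
qed

text \<open>Bubble sort: while the word above \<open>last c\<close> has an ascent, the switching
  property allows an exchange there, which lowers \<open>noninversions\<close>. The prefix
  \<open>c\<close> stays fixed so that the result also serves intervals of \<open>Q\<close> that
  start at the class of \<open>c\<close>.\<close>

lemma sort_chain:
  assumes "c @ e \<in> CH" "c \<noteq> []"
  shows "\<exists>e'. c @ e' \<in> CH \<and> last (c @ e') = last (c @ e) \<and> mset (lw (c @ e')) = mset (lw (c @ e)) \<and>
    successively (\<lambda>a b. \<not> a < b) (lw (last c # e')) \<and> (quad_exchange P le lab)\<^sup>*\<^sup>* (c @ e) (c @ e')"
  using assms(1)
proof (induction "noninversions (lw (last c # e))" arbitrary: e rule: less_induct)
  case less
  show ?case
  proof (cases "successively (\<lambda>a b. \<not> a < b) (lw (last c # e))")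
    case True
    then show ?thesis using less.prems by blast
  next
    case False
    let ?l = "last c # e"
    obtain i where i: "Suc i < length (lw ?l)" "lw ?l ! i < lw ?l ! Suc i"
      using False by (auto simp: successively_conv_nth)
    define x y z q where "x = ?l ! i" "y = ?l ! Suc i" "z = ?l ! Suc (Suc i)" "q = drop (Suc (Suc (Suc i))) ?l"
    note defs = this
    have l: "?l = take i ?l @ x # y # z # q"
      using i(1) unfolding defs by (intro take_nth3_drop[symmetric]) simp
    have lt: "lab x y < lab y z" using i unfolding defs by (simp add: nth_label_word)
    have bl: "butlast c @ ?l = c @ e" using assms(2) by simp
    have C: "c @ e = (butlast c @ take i ?l) @ x # y # z # q" using l bl by simp
    obtain y' where y': "quad_exchange P le lab (c @ e) ((butlast c @ take i ?l) @ x # y' # z # q)"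
      "lab x y' = lab y z" "lab y' z = lab x y"
      using switch[of "butlast c @ take i ?l" x y z q] less.prems lt unfolding C by blast
    \<comment> \<open>The exchanged element \<open>y\<close> is never the first one of
      \<open>last c # e\<close>.\<close>
    have "\<exists>f. take i ?l @ x # y' # z # q = last c # f"
      using l by (cases i) auto
    then obtain f where f: "take i ?l @ x # y' # z # q = last c # f" by blast
    have ex: "quad_exchange P le lab (c @ e) (c @ f)"
      using y'(1) f assms(2) by (metis append_assoc append_butlast_last_id append_Cons append_Nil)
    then have inv: "c @ f \<in> CH" "last (c @ f) = last (c @ e)" "mset (lw (c @ f)) = mset (lw (c @ e))"
      using quad_exchange_CH less.prems by blast+
    have "noninversions (lw (last c # f)) < noninversions (lw ?l)"
      using noninversions_swap[OF lt] y'(2,3) unfolding f[symmetric] by (subst l) (simp add: label_word_mid)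
    from less.hyps[OF this inv(1)] obtain e' where
      "c @ e' \<in> CH" "last (c @ e') = last (c @ f)" "mset (lw (c @ e')) = mset (lw (c @ f))"
      "successively (\<lambda>a b. \<not> a < b) (lw (last c # e'))" "(quad_exchange P le lab)\<^sup>*\<^sup>* (c @ f) (c @ e')"
      by blast
    with inv ex show ?thesis by (metis converse_rtranclp_into_rtranclp)
  qed
qed

lemma sort_CH:
  assumes "c \<in> CH"
  shows "\<exists>d\<in>CH. last d = last c \<and> mset (lw d) = mset (lw c) \<and>
    successively (\<lambda>a b. \<not> a < b) (lw d) \<and> (quad_exchange P le lab)\<^sup>*\<^sup>* c d"
proof -
  obtain e where "[b0] @ e \<in> CH" "last ([b0] @ e) = last c" "mset (lw ([b0] @ e)) = mset (lw c)"
      "successively (\<lambda>a b. \<not> a < b) (lw (last [b0] # e))" "(quad_exchange P le lab)\<^sup>*\<^sup>* c ([b0] @ e)"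
    using sort_chain[of "[b0]" "tl c"] assms unfolding CH_tl[OF assms] by blast
  then show ?thesis by (intro bexI[of _ "[b0] @ e"]) auto
qed

text \<open>Exchanges keep the top and the label multiset. Conversely, both chains sort to weakly
  decreasing chains with the same top and multiset, hence with the same word, and words are
  injective on the maximal chains of an interval.\<close>

lemma chain_equiv_iff:
  "chain_equiv P le b0 lab c d \<longleftrightarrow> c \<in> CH \<and> d \<in> CH \<and> last c = last d \<and> mset (lw c) = mset (lw d)"
proof
  assume "chain_equiv P le b0 lab c d"
  then show "c \<in> CH \<and> d \<in> CH \<and> last c = last d \<and> mset (lw c) = mset (lw d)"
    by (auto simp: chain_equiv_def dest: quad_exchange_invariants)
next
  assume h: "c \<in> CH \<and> d \<in> CH \<and> last c = last d \<and> mset (lw c) = mset (lw d)"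
  let ?E = "quad_exchange P le lab"
  have sorted: "\<exists>c'. c' \<in> CH \<and> last c' = last c \<and> mset (lw c') = mset (lw c) \<and>
     successively (\<lambda>a b. \<not> a < b) (lw c') \<and> (symclp ?E)\<^sup>*\<^sup>* c c'" if c: "c \<in> CH" for c
  proof -
    obtain d where d: "d \<in> CH" "last d = last c" "mset (lw d) = mset (lw c)"
      "successively (\<lambda>a b. \<not> a < b) (lw d)" "?E\<^sup>*\<^sup>* c d"
      using sort_CH[OF c] by blast
    moreover have "(symclp ?E)\<^sup>*\<^sup>* c d"
      using d(5) by (rule rtranclp_mono[THEN predicate2D, rotated]) (auto simp: symclp_def)
    ultimately show ?thesis by blast
  qed
  obtain c' d' where c': "c' \<in> CH" "last c' = last c" "mset (lw c') = mset (lw c)"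
      "successively (\<lambda>a b. \<not> a < b) (lw c')" "(symclp ?E)\<^sup>*\<^sup>* c c'"
    and d': "d' \<in> CH" "last d' = last d" "mset (lw d') = mset (lw d)"
      "successively (\<lambda>a b. \<not> a < b) (lw d')" "(symclp ?E)\<^sup>*\<^sup>* d d'"
    using sorted h by meson
  have "lw c' = lw d'" using c' d' h by (intro descending_unique) auto
  then have "c' = d'" using words_inj CH_maxchain c' d' h by metis
  moreover have "(symclp ?E)\<^sup>*\<^sup>* d' d"
    using d'(5) by (rule sympD[OF symp_rtranclp_symclp])
  ultimately have "(symclp ?E)\<^sup>*\<^sup>* c d" using c'(5) by (metis rtranclp_trans)
  then show "chain_equiv P le b0 lab c d" using h by (simp add: chain_equiv_def)
qed

section \<open>The order and the covers of \<open>Q\<close>\<close>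

definition cls :: "'a list \<Rightarrow> 'a list set" where
  "cls c = {d. chain_equiv P le b0 lab c d}"

lemma mem_cls: "d \<in> cls c \<longleftrightarrow> c \<in> CH \<and> d \<in> CH \<and> last c = last d \<and> mset (lw c) = mset (lw d)"
  by (simp add: cls_def chain_equiv_iff)

lemma cls_self: "c \<in> CH \<Longrightarrow> c \<in> cls c"
  by (simp add: mem_cls)

lemma cls_eq_iff:
  "c \<in> CH \<Longrightarrow> d \<in> CH \<Longrightarrow> cls c = cls d \<longleftrightarrow> last c = last d \<and> mset (lw c) = mset (lw d)"
  using cls_self by (auto simp: mem_cls set_eq_iff)

lemma cls_eqI: "d \<in> cls c \<Longrightarrow> cls d = cls c"
  by (auto simp: mem_cls cls_eq_iff)

lemma Q_eq: "Q = cls ` CH"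
  by (simp add: Q_carrier_def cls_def image_def)

lemma cls_length: "c \<in> CH \<Longrightarrow> d \<in> CH \<Longrightarrow> cls c = cls d \<Longrightarrow> length c = length d"
  using CH_nonempty[of c] CH_nonempty[of d]
  by (cases c; cases d) (auto simp: cls_eq_iff dest: mset_eq_length)

text \<open>Only the top and the label multiset matter, and appending \<open>e\<close> changes both
  in the same way for \<open>c\<close> and \<open>c'\<close>. Extension is thus well defined on
  classes.\<close>

lemma extend_cong:
  assumes "c \<in> CH" "c' \<in> CH" "cls c = cls c'" "c @ e \<in> CH"
  shows "c' @ e \<in> CH" "cls (c' @ e) = cls (c @ e)"
proof -
  have ne: "c \<noteq> []" "c' \<noteq> []" using assms CH_nonempty by auto
  show m: "c' @ e \<in> CH" using assms ne by (simp add: CH_append cls_eq_iff)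
  show "cls (c' @ e) = cls (c @ e)"
    using assms ne m by (auto simp: cls_eq_iff label_word_append last_append)
qed

lemma CH_rank_nth:
  assumes "c \<in> CH" "i < length c"
  shows "rk (c ! i) = i"
  using rank_eq[OF maxchain_split(1)[OF CH_maxchain[OF assms(1)] assms(2)]] assms(2) by simp

text \<open>In a chain from \<open>b0\<close> the element at position \<open>i\<close> has rank
  \<open>i\<close>, so a common element sits at the same position in both chains.\<close>

lemma CH_subset_prefix:
  assumes "c \<in> CH" "d \<in> CH" "set c \<subseteq> set d"
  shows "\<exists>e. d = c @ e"
proof -
  have nth: "i < length d \<and> c ! i = d ! i" if "i < length c" for i
  proof -
    have "c ! i \<in> set d" using assms(3) that by auto
    then obtain j where j: "j < length d" "d ! j = c ! i" by (auto simp: in_set_conv_nth)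
    then have "i = j" using CH_rank_nth[OF assms(1) that] CH_rank_nth[OF assms(2) j(1)] by simp
    then show ?thesis using j by simp
  qed
  have "length c \<le> length d" 
    using nth[of "length c - 1"] CH_nonempty[OF assms(1)] by (cases "length c") auto
  then have "c = take (length c) d" using nth by (intro nth_equalityI) auto
  then show ?thesis by (metis append_take_drop_id)
qed

text \<open>The transitive closure collapses: each further inclusion is carried over to the chain
  built so far, so that a whole sequence of inclusions is realised by one chain and a prefix of
  it.\<close>

lemma Q_le_iff: "Qle X Y \<longleftrightarrow> (\<exists>c e. c \<noteq> [] \<and> c @ e \<in> CH \<and> X = cls c \<and> Y = cls (c @ e))"
proof
  assume "Qle X Y"
  then have X: "X \<in> Q" and st: "(\<lambda>A B. A \<in> Q \<and> B \<in> Q \<and> (\<exists>c\<in>A. \<exists>d\<in>B. set c \<subseteq> set d))\<^sup>*\<^sup>* X Y"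
    by (auto simp: Q_le_def)
  from st show "\<exists>c e. c \<noteq> [] \<and> c @ e \<in> CH \<and> X = cls c \<and> Y = cls (c @ e)"
  proof (induction rule: rtranclp_induct)
    case base
    obtain c where "c \<in> CH" "X = cls c" using X by (auto simp: Q_eq)
    then show ?case using CH_nonempty by (intro exI[of _ c] exI[of _ "[]"]) auto
  next
    case (step Y Z)
    then obtain c e c' d where h: "c \<noteq> []" "c @ e \<in> CH" "X = cls c" "Y = cls (c @ e)"
      "c' \<in> Y" "d \<in> Z" "set c' \<subseteq> set d" and "Z \<in> Q" by blast
    obtain d0 where "Z = cls d0" using \<open>Z \<in> Q\<close> by (auto simp: Q_eq)
    then have d: "d \<in> CH" "Z = cls d" using h(6) cls_eqI[of d d0] by (simp_all add: mem_cls)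
    have c': "c' \<in> CH" "cls c' = cls (c @ e)"
      using h(4,5) cls_eqI[of c' "c @ e"] by (simp_all add: mem_cls)
    obtain f where f: "d = c' @ f" using CH_subset_prefix[OF c'(1) d(1) h(7)] by blast
    \<comment> \<open>The extension \<open>f\<close> of \<open>c'\<close> is moved onto
      \<open>c @ e\<close>, which lies in the same class.\<close>
    have "(c @ e) @ f \<in> CH" "cls ((c @ e) @ f) = cls (c' @ f)"
      using extend_cong[OF c'(1) h(2) c'(2), of f] d(1) unfolding f by simp_all
    then show ?case using h(1,3) d(2) f by (intro exI[of _ c] exI[of _ "e @ f"]) simp
  qed
next
  assume "\<exists>c e. c \<noteq> [] \<and> c @ e \<in> CH \<and> X = cls c \<and> Y = cls (c @ e)"
  then obtain c e where h: "c \<noteq> []" "c @ e \<in> CH" "X = cls c" "Y = cls (c @ e)" by blast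
  then have c: "c \<in> CH" by (simp add: CH_append)
  have "\<exists>c\<in>X. \<exists>d\<in>Y. set c \<subseteq> set d"
    using h(3,4) cls_self[OF c] cls_self[OF h(2)] by (intro bexI[of _ c] bexI[of _ "c @ e"]) simp_all
  moreover have "X \<in> Q" "Y \<in> Q" using h c by (simp_all add: Q_eq)
  ultimately show "Qle X Y" unfolding Q_le_def by (intro conjI r_into_rtranclp)
qed

text \<open>The representative of the lower class may be prescribed, since extensions transfer
  between members of a class.\<close>

lemma Q_le_cls: "c \<in> CH \<Longrightarrow> Qle (cls c) Y \<longleftrightarrow> (\<exists>e. c @ e \<in> CH \<and> Y = cls (c @ e))"
proof
  assume c: "c \<in> CH" and "Qle (cls c) Y"
  then obtain c' e where h: "c' \<noteq> []" "c' @ e \<in> CH" "cls c = cls c'" "Y = cls (c' @ e)"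
    unfolding Q_le_iff by blast
  then have "c' \<in> CH" by (simp add: CH_append)
  from extend_cong[OF this c h(3)[symmetric] h(2)] show "\<exists>e. c @ e \<in> CH \<and> Y = cls (c @ e)"
    using h(4) by auto
qed (use CH_nonempty in \<open>auto simp: Q_le_iff\<close>)

text \<open>Length is constant on classes and acts as a rank: a longer extension passes through the
  class of its first step, and an extension by one element leaves no room.\<close>

lemma Q_covers_cls:
  assumes "c \<in> CH"
  shows "covers Q Qle (cls c) Y \<longleftrightarrow> (\<exists>z. c @ [z] \<in> CH \<and> Y = cls (c @ [z]))"
proof
  assume cov: "covers Q Qle (cls c) Y"
  then have "Qle (cls c) Y" "cls c \<noteq> Y" by (simp_all add: covers_def)
  then obtain e where e: "c @ e \<in> CH" "Y = cls (c @ e)" "e \<noteq> []"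
    using Q_le_cls[OF assms] by (metis append_Nil2)
  then obtain z f where f: "e = z # f" by (cases e) auto
  have ne: "c \<noteq> []" using CH_nonempty assms by blast
  have cz: "c @ [z] \<in> CH" using e f CH_append[of "c @ [z]" f] by simp
  have "Qle (cls c) (cls (c @ [z]))" using Q_le_cls[OF assms] cz by blast
  moreover have "Qle (cls (c @ [z])) Y"
    unfolding Q_le_cls[OF cz] using e f by (intro exI[of _ f]) simp
  moreover have "cls (c @ [z]) \<noteq> cls c" using cls_length[OF cz assms] by auto
  moreover have "cls (c @ [z]) \<in> Q" using cz by (simp add: Q_eq)
  ultimately have "Y = cls (c @ [z])" using cov unfolding covers_def by blast
  with cz show "\<exists>z. c @ [z] \<in> CH \<and> Y = cls (c @ [z])" by blast
next
  assume "\<exists>z. c @ [z] \<in> CH \<and> Y = cls (c @ [z])"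
  then obtain z where z: "c @ [z] \<in> CH" "Y = cls (c @ [z])" by blast
  have "cls c \<noteq> Y" using cls_length[OF assms z(1)] z(2) by auto
  moreover have "W = cls c \<or> W = Y" if W: "Qle (cls c) W" "Qle W Y" for W
  proof -
    obtain e where e: "c @ e \<in> CH" "W = cls (c @ e)" using W(1) Q_le_cls[OF assms] by blast
    obtain f where f: "(c @ e) @ f \<in> CH" "Y = cls ((c @ e) @ f)"
      using W(2) Q_le_cls[OF e(1)] unfolding e(2) by blast
    have "length (e @ f) = 1" using cls_length[OF z(1) f(1)] z f by simp
    then have "e = [] \<or> f = []" by (cases e; cases f) auto
    then show ?thesis using e f by auto
  qed
  moreover have "Qle (cls c) Y" using z Q_le_cls[OF assms] by blast
  moreover have "cls c \<in> Q" "Y \<in> Q" using z assms by (simp_all add: Q_eq)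
  ultimately show "covers Q Qle (cls c) Y" unfolding covers_def by blast
qed

section \<open>Lifting chains from \<open>P\<close> to \<open>Q\<close>\<close>

text \<open>The lift to \<open>Q\<close> of the part of \<open>c @ e\<close> above \<open>c\<close>:
  the classes of its growing prefixes.\<close>

fun qchain :: "'a list \<Rightarrow> 'a list \<Rightarrow> 'a list set list" where
  "qchain c [] = [cls c]"
| "qchain c (z # e) = cls c # qchain (c @ [z]) e"

text \<open>The choice is harmless, as all chains of a class end at the same element.\<close>

definition chain_end :: "'a list set \<Rightarrow> 'a" where
  "chain_end X = last (SOME c. c \<in> X)"

definition qlab :: "'a list set \<Rightarrow> 'a list set \<Rightarrow> 'l" where
  "qlab X Y = lab (chain_end X) (chain_end Y)"

lemma chain_end_cls: "c \<in> CH \<Longrightarrow> chain_end (cls c) = last c"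
  unfolding chain_end_def using someI[of "\<lambda>d. d \<in> cls c", OF cls_self] by (simp add: mem_cls)

lemma qchain_Cons: "qchain c e = cls c # tl (qchain c e)"
  by (cases e) auto

lemma qchain_simps [simp]:
  "qchain c e \<noteq> []" "hd (qchain c e) = cls c" "length (qchain c e) = Suc (length e)"
  "last (qchain c e) = cls (c @ e)"
  by (induction c e rule: qchain.induct) auto

lemma qchain_sat_chain:
  assumes "c \<in> CH" "c @ e \<in> CH"
  shows "is_sat_chain Q Qle (qchain c e)"
    and "label_word qlab (qchain c e) = lw (last c # e)"
    and "map chain_end (qchain c e) = last c # e"
proof -
  have "is_sat_chain Q Qle (qchain c e) \<and> label_word qlab (qchain c e) = lw (last c # e)
     \<and> map chain_end (qchain c e) = last c # e"
    using assms
  proof (induction e arbitrary: c)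
    case Nil
    then show ?case by (simp add: Q_eq chain_end_cls)
  next
    case (Cons z e)
    have cz: "c @ [z] \<in> CH" using Cons.prems CH_append[of "c @ [z]" e] by simp
    have IH: "is_sat_chain Q Qle (qchain (c @ [z]) e)"
      "label_word qlab (qchain (c @ [z]) e) = lw (z # e)" "map chain_end (qchain (c @ [z]) e) = z # e"
      using Cons.IH[OF cz] Cons.prems(2) by auto
    have "covers Q Qle (cls c) (cls (c @ [z]))"
      using Q_covers_cls[OF Cons.prems(1)] cz by blast
    moreover have "qlab (cls c) (cls (c @ [z])) = lab (last c) z"
      using Cons.prems(1) cz by (simp add: qlab_def chain_end_cls)
    moreover obtain r where "qchain (c @ [z]) e = cls (c @ [z]) # r" using qchain_Cons by blast
    ultimately show ?case using IH Cons.prems(1) by (simp add: chain_end_cls)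
  qed
  then show "is_sat_chain Q Qle (qchain c e)"
    "label_word qlab (qchain c e) = lw (last c # e)" "map chain_end (qchain c e) = last c # e" by blast+
qed

text \<open>Each cover of \<open>Q\<close> extends the current representative by one element, so a
  saturated chain of \<open>Q\<close> unrolls into a chain of \<open>P\<close> above any prescribed
  representative.\<close>

lemma sat_chain_qchain:
  assumes "is_sat_chain Q Qle (cls c # D)" "c \<in> CH"
  shows "\<exists>e. c @ e \<in> CH \<and> cls c # D = qchain c e"
  using assms
proof (induction D arbitrary: c)
  case Nil
  then show ?case by (intro exI[of _ "[]"]) simp
next
  case (Cons Z D)
  then obtain z where z: "c @ [z] \<in> CH" "Z = cls (c @ [z])"
    using Q_covers_cls[of c Z] by auto
  with Cons obtain e where "(c @ [z]) @ e \<in> CH" "Z # D = qchain (c @ [z]) e" by fastforce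
  then show ?case by (intro exI[of _ "z # e"]) simp
qed

lemma maxchain_Q_iff:
  assumes "c \<in> CH"
  shows "maxchain Q Qle (cls c) Y D \<longleftrightarrow> (\<exists>e. c @ e \<in> CH \<and> D = qchain c e \<and> Y = cls (c @ e))"
proof
  assume D: "maxchain Q Qle (cls c) Y D"
  then have "D = cls c # tl D" by (cases D) (auto simp: maxchain_def is_sat_chain_def)
  with D obtain e where "c @ e \<in> CH" "D = qchain c e"
    using sat_chain_qchain[OF _ assms, of "tl D"] by (auto simp: maxchain_def)
  with D show "\<exists>e. c @ e \<in> CH \<and> D = qchain c e \<and> Y = cls (c @ e)"
    by (auto simp: maxchain_def)
qed (use assms in \<open>auto simp: maxchain_def qchain_sat_chain\<close>)

lemma qchain_inj:
  "\<lbrakk>c \<in> CH; c @ e \<in> CH; c @ e' \<in> CH; qchain c e = qchain c e'\<rbrakk> \<Longrightarrow> e = e'"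
  using qchain_sat_chain(3)[of c e] qchain_sat_chain(3)[of c e'] by (metis list.inject)

lemma Q_bot_eq: "Q_bot P le b0 lab = cls [b0]"
  by (simp add: Q_bot_def cls_def)

section \<open>Gradedness, descending chains and Whitney numbers of \<open>Q\<close>\<close>

text \<open>Length, being constant on classes, decides the order properties: an extension that
  returns to the same class is empty, and lifts that end in one class are equally long.\<close>

lemma Q_graded: "graded_with_bottom Q Qle (cls [b0])"
proof -
  have "finite CH" unfolding sat_chains_from_def by (rule finite_chains)
  then have "finite Q" by (simp add: Q_eq)
  moreover have "is_poset Q Qle"
    unfolding is_poset_def
  proof (intro conjI ballI impI)
    fix X assume "X \<in> Q"
    then show "Qle X X" by (simp add: Q_le_def)
  next
    fix X Y Z assume "Qle X Y \<and> Qle Y Z"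
    then show "Qle X Z" unfolding Q_le_def by (meson rtranclp_trans)
  next
    fix X Y assume XY: "X \<in> Q" "Qle X Y \<and> Qle Y X"
    then obtain c where c: "c \<in> CH" "X = cls c" by (auto simp: Q_eq)
    obtain e where e: "c @ e \<in> CH" "Y = cls (c @ e)"
      using XY Q_le_cls[OF c(1)] unfolding c(2) by blast
    obtain f where f: "(c @ e) @ f \<in> CH" "X = cls ((c @ e) @ f)"
      using XY Q_le_cls[OF e(1)] unfolding e(2) by blast
    have "length (e @ f) = 0" using cls_length[OF c(1) f(1)] c f by simp
    then show "X = Y" using c e by simp
  qed
  moreover have "Qle (cls [b0]) X" if X: "X \<in> Q" for X
    using X CH_tl unfolding Q_le_cls[OF bot_CH] Q_eq by (metis imageE)
  moreover have "length C = length D" 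
    if CD: "maxchain Q Qle (cls [b0]) X C" "maxchain Q Qle (cls [b0]) X D" for X C D
  proof -
    obtain e where e: "[b0] @ e \<in> CH" "C = qchain [b0] e" "X = cls ([b0] @ e)"
      using CD(1) unfolding maxchain_Q_iff[OF bot_CH] by blast
    obtain f where f: "[b0] @ f \<in> CH" "D = qchain [b0] f" "X = cls ([b0] @ f)"
      using CD(2) unfolding maxchain_Q_iff[OF bot_CH] by blast
    have "length ([b0] @ e) = length ([b0] @ f)" using cls_length[OF e(1) f(1)] e(3) f(3) by blast
    then show ?thesis using e(2) f(2) by simp
  qed
  ultimately show ?thesis using bot_CH by (auto simp: graded_with_bottom_def Q_eq)
qed

text \<open>Existence comes from sorting the part above a representative \<open>c\<close>. For
  uniqueness, extensions of \<open>c\<close> into the same class have equal label multisets, so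
  their weakly decreasing words agree, and words determine chains of \<open>P\<close>.\<close>

lemma Q_unique_descending:
  assumes "X \<in> Q" "Qle X Y"
  shows "\<exists>!D. maxchain Q Qle X Y D \<and> successively (\<lambda>a b. \<not> a < b) (label_word qlab D)"
proof -
  obtain c where c: "c \<in> CH" "X = cls c" using assms by (auto simp: Q_eq)
  then have ne: "c \<noteq> []" using CH_nonempty by auto
  obtain e where e: "c @ e \<in> CH" "Y = cls (c @ e)"
    using assms(2) Q_le_cls[OF c(1)] unfolding c(2) by blast
  obtain e' where e': "c @ e' \<in> CH" "last (c @ e') = last (c @ e)" "mset (lw (c @ e')) = mset (lw (c @ e))"
    and desc: "successively (\<lambda>a b. \<not> a < b) (lw (last c # e'))"
    using sort_chain[OF e(1) ne] by blast
  show ?thesis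
  proof (rule ex1I[of _ "qchain c e'"])
    show "maxchain Q Qle X Y (qchain c e') \<and> successively (\<lambda>a b. \<not> a < b) (label_word qlab (qchain c e'))"
    proof
      have "Y = cls (c @ e')" using e e' by (simp add: cls_eq_iff)
      then show "maxchain Q Qle X Y (qchain c e')"
        using c e' maxchain_Q_iff[OF c(1)] by blast
      show "successively (\<lambda>a b. \<not> a < b) (label_word qlab (qchain c e'))"
        using desc qchain_sat_chain(2)[OF c(1) e'(1)] by simp
    qed
  next
    fix D assume D: "maxchain Q Qle X Y D \<and> successively (\<lambda>a b. \<not> a < b) (label_word qlab D)"
    then obtain f where f: "c @ f \<in> CH" "D = qchain c f" "Y = cls (c @ f)"
      using c(2) maxchain_Q_iff[OF c(1)] by blast
    have eq: "last (c @ f) = last (c @ e')" "mset (lw (c @ f)) = mset (lw (c @ e'))"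
      using e e' f by (auto simp: cls_eq_iff)
    \<comment> \<open>Both full words start with \<open>lw c\<close>, so equality of multisets
      passes to the parts above \<open>c\<close>.\<close>
    have "lw (last c # f) = lw (last c # e')"
      using D desc eq(2) ne f c by (intro descending_unique) (simp_all add: qchain_sat_chain label_word_append)
    then have "lw (c @ f) = lw (c @ e')" using ne by (simp add: label_word_append)
    then have "c @ f = c @ e'"
      using words_inj[OF CH_maxchain[OF f(1)]] CH_maxchain[OF e'(1)] eq(1) by simp
    then show "D = qchain c e'" using f by simp
  qed
qed

text \<open>The Moebius computation is reused with weak decrease as \<open>R\<close>; the falling
  chains of \<open>Q\<close> are then the strictly increasing ones.\<close>

sublocale Q: ER_poset Q Qle "cls [b0]" qlab "\<lambda>a b. \<not> a < b"
  by unfold_locales (use Q_graded Q_unique_descending in blast)+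

lemma Q_rank: "c \<in> CH \<Longrightarrow> Q.rk (cls c) = length c - 1"
proof -
  assume c: "c \<in> CH"
  then have "maxchain Q Qle (cls [b0]) (cls c) (qchain [b0] (tl c))"
    unfolding maxchain_Q_iff[OF bot_CH] by (intro exI[of _ "tl c"]) (simp only: CH_tl simp_thms)
  from Q.rank_eq[OF this] show ?thesis by simp
qed

lemma Q_cases: "X \<in> Q \<Longrightarrow> \<exists>c\<in>CH. X = cls c" and cls_in_Q: "c \<in> CH \<Longrightarrow> cls c \<in> Q"
  by (auto simp: Q_eq)

text \<open>By \<open>whitney_first_abs\<close> the first Whitney numbers count, up to sign, the
  ascent-free chains of \<open>P\<close> and the strictly increasing chains of \<open>Q\<close>.
  Bijections match these with the elements of the other poset.\<close>

theorem Q_whitney_dual: "whitney_duals P le b0 Q Qle (Q_bot P le b0 lab)"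
  unfolding whitney_duals_def Q_bot_eq
proof (intro conjI allI)
  fix k
  \<comment> \<open>Every class contains exactly one chain with weakly decreasing word.\<close>
  have "bij_betw cls {c. c \<in> CH \<and> length c = Suc k \<and> successively (\<lambda>a b. \<not> a < b) (lw c)}
      {X\<in>Q. Q.rk X = k}" (is "bij_betw _ ?A ?B")
  proof (rule bij_betwI')
    fix c d assume "c \<in> ?A" "d \<in> ?A"
    then have h: "c \<in> CH" "d \<in> CH" "mset (lw c) = mset (lw d) \<Longrightarrow> lw c = lw d"
      using descending_unique by blast+
    then show "(cls c = cls d) = (c = d)"
      using words_inj[OF CH_maxchain[OF h(1)], of d] CH_maxchain[OF h(2)] cls_eq_iff[OF h(1,2)] by metis
  next
    fix c assume "c \<in> ?A"
    then show "cls c \<in> ?B" by (simp add: Q_rank cls_in_Q)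
  next
    fix X assume "X \<in> ?B"
    then have "X \<in> Q" "Q.rk X = k" by simp_all
    then obtain c where c: "c \<in> CH" "X = cls c" "length c - 1 = k"
      using Q_cases[of X] Q_rank by metis
    obtain d where d: "d \<in> CH" "last d = last c" "mset (lw d) = mset (lw c)"
      "successively (\<lambda>a b. \<not> a < b) (lw d)"
      using sort_CH[OF c(1)] by blast
    then have X: "X = cls d" using c by (simp add: cls_eq_iff)
    then have "length c = length d" using cls_length[OF c(1) d(1)] c(2) by blast
    then have "length d = Suc k" using c(3) CH_nonempty[OF c(1)] by (cases c) auto
    then show "\<exists>c\<in>?A. X = cls c" using d X by blast
  qed
  from bij_betw_same_card[OF this]
  show "\<bar>whitney_first P le b0 k\<bar> = int (whitney_second Q Qle (cls [b0]) k)"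
    by (simp add: whitney_first_abs whitney_second_def)
  let ?I = "{c. c \<in> CH \<and> length c = Suc k \<and> successively (<) (lw c)}"
  \<comment> \<open>Every element of \<open>P\<close> is the top of exactly one strictly increasing
    chain from \<open>b0\<close>.\<close>
  have "bij_betw last ?I {x\<in>P. rk x = k}"
  proof (rule bij_betwI')
    fix c d assume "c \<in> ?I" "d \<in> ?I"
    then show "(last c = last d) = (c = d)"
      using rising_eqI[OF CH_maxchain] by auto metis
  next
    fix c assume "c \<in> ?I"
    then show "last c \<in> {x\<in>P. rk x = k}"
      using rank_eq[OF CH_maxchain] maxchain_in[OF CH_maxchain] by auto
  next
    fix x assume x: "x \<in> {x\<in>P. rk x = k}"
    then have r: "maxchain P le b0 x (rising b0 x)" "successively (<) (lw (rising b0 x))"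
      using rising bot_in bot_le by auto
    then have "length (rising b0 x) = Suc k"
      using x rank_eq[OF r(1)] maxchain_in[OF r(1)] by (cases "rising b0 x") auto
    then have "rising b0 x \<in> ?I" "last (rising b0 x) = x" using r by (auto simp: sat_chains_from_def maxchain_def)
    then show "\<exists>c\<in>?I. x = last c" by metis
  qed
  \<comment> \<open>Lifting keeps words, so it matches the strictly increasing chains of
    \<open>P\<close> and \<open>Q\<close>; the double negation is the falling condition in
    \<open>Q\<close>.\<close>
  moreover have "bij_betw (\<lambda>c. qchain [b0] (tl c)) ?I
    {D. D \<in> sat_chains_from Q Qle (cls [b0]) \<and> length D = Suc k \<and>
      successively (\<lambda>a b. \<not> \<not> a < b) (label_word qlab D)}" (is "bij_betw _ _ ?J")
  proof (rule bij_betwI')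
    fix c d assume "c \<in> ?I" "d \<in> ?I"
    then show "(qchain [b0] (tl c) = qchain [b0] (tl d)) = (c = d)"
      using qchain_inj[OF bot_CH, of "tl c" "tl d"] CH_tl by auto metis
  next
    fix c assume c: "c \<in> ?I"
    then have "[b0] @ tl c \<in> CH" by (simp only: CH_tl mem_Collect_eq)
    from qchain_sat_chain[OF bot_CH this] show "qchain [b0] (tl c) \<in> ?J"
      using c CH_tl[of c] by (auto simp: sat_chains_from_def)
  next
    fix D assume D: "D \<in> ?J"
    then have "maxchain Q Qle (cls [b0]) (last D) D" by (simp add: sat_chains_from_def maxchain_def)
    then obtain e where "[b0] @ e \<in> CH" "D = qchain [b0] e"
      unfolding maxchain_Q_iff[OF bot_CH] by blast
    then show "\<exists>c\<in>?I. D = qchain [b0] (tl c)"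
      using D qchain_sat_chain[OF bot_CH] by (intro bexI[of _ "[b0] @ e"]) auto
  qed
  ultimately show "\<bar>whitney_first Q Qle (cls [b0]) k\<bar> = int (whitney_second P le b0 k)"
    by (simp add: Q.whitney_first_abs whitney_second_def flip: bij_betw_same_card)
qed (use graded Q_graded in auto)

end

section \<open>Noncrossing partitions\<close>

text \<open>Not symmetric: the first set supplies the smallest of the four points, so both
  directions have to be excluded.\<close>

definition crosses :: "nat set \<Rightarrow> nat set \<Rightarrow> bool" where
  "crosses B C \<longleftrightarrow> (\<exists>a b c d. a < b \<and> b < c \<and> c < d \<and> a \<in> B \<and> c \<in> B \<and> b \<in> C \<and> d \<in> C)"

lemma noncrossing_iff: "noncrossing \<pi> \<longleftrightarrow> (\<forall>B\<in>\<pi>. \<forall>C\<in>\<pi>. B \<noteq> C \<longrightarrow> \<not> crosses B C)"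
  unfolding noncrossing_def crosses_def[symmetric] by blast

lemma crosses_mono: "crosses B C \<Longrightarrow> B \<subseteq> B' \<Longrightarrow> C \<subseteq> C' \<Longrightarrow> crosses B' C'"
  unfolding crosses_def by blast

text \<open>The position of a mergeable pair, stated without \<open>Min\<close> and
  \<open>Max\<close>: all of \<open>E\<close> fits into the gap of \<open>D\<close> right after
  \<open>a\<close>. For finite nonempty blocks \<open>a\<close> is then the label of the
  merge.\<close>

definition hooks :: "nat set \<Rightarrow> nat set \<Rightarrow> nat \<Rightarrow> bool" where
  "hooks D E a \<longleftrightarrow> a \<in> D \<and> (\<forall>e\<in>E. a < e) \<and> (\<forall>d\<in>D. d \<le> a \<or> (\<forall>e\<in>E. e < d))"

lemma hooksI:
  "a \<in> D \<Longrightarrow> (\<And>e. e \<in> E \<Longrightarrow> a < e) \<Longrightarrow> (\<And>d e. d \<in> D \<Longrightarrow> e \<in> E \<Longrightarrow> a < d \<Longrightarrow> e < d) \<Longrightarrow> hooks D E a"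
  unfolding hooks_def by (meson not_le)

lemma hooksD:
  assumes "hooks D E a"
  shows "a \<in> D" "e \<in> E \<Longrightarrow> a < e" "d \<in> D \<Longrightarrow> e \<in> E \<Longrightarrow> a < d \<Longrightarrow> e < d"
  using assms unfolding hooks_def by (blast, blast, meson not_le)

lemma hooks_not_crosses: "hooks D E a \<Longrightarrow> \<not> crosses D E \<and> \<not> crosses E D"
  unfolding hooks_def crosses_def by (metis less_trans not_le le_less_trans less_asym)

lemma hooks_Min_less:
  assumes "hooks D E a" "finite D" "finite E" "E \<noteq> {}"
  shows "Min D < Min E" "Max {d\<in>D. d < Min E} = a"
proof -
  have a: "a \<in> D" "a < Min E" using assms by (auto simp: hooks_def)
  then show "Min D < Min E" using assms(2) by (meson Min_le le_less_trans)
  show "Max {d\<in>D. d < Min E} = a"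
  proof (rule Max_eqI)
    fix d assume "d \<in> {d\<in>D. d < Min E}"
    then show "d \<le> a" using assms(1) Min_in[OF assms(3,4)] unfolding hooks_def
      by (metis (mono_tags, lifting) mem_Collect_eq less_asym)
  qed (use a assms(2) in auto)
qed

definition merge :: "nat set set \<Rightarrow> nat set \<Rightarrow> nat set \<Rightarrow> nat set set" where
  "merge x D E = insert (D \<union> E) (x - {D, E})"

lemma merge_commute: "merge x D E = merge x E D"
  by (auto simp: merge_def Un_commute)

lemma refines_refl: "refines x x"
  by (auto simp: refines_def)

lemma refines_trans: "refines x y \<Longrightarrow> refines y z \<Longrightarrow> refines x z"
  unfolding refines_def by (meson order_trans)

lemma refines_merge: "refines x (merge x D E)"
  by (auto simp: refines_def merge_def)

lemma merge_partition:
  assumes "partition_on A x" "D \<in> x" "E \<in> x"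
  shows "partition_on A (merge x D E)"
proof (rule partition_onI)
  show "\<Union> (merge x D E) = A" using assms partition_onD1[OF assms(1)] by (auto simp: merge_def)
  show "disjnt p q" if "p \<in> merge x D E" "q \<in> merge x D E" "p \<noteq> q" for p q
  proof -
    have disj: "B \<inter> C = {}" if "B \<in> x" "C \<in> x" "B \<noteq> C" for B C
      using partition_onD2[OF assms(1)] that by (auto simp: disjoint_def)
    have "(D \<union> E) \<inter> B = {}" if "B \<in> x - {D, E}" for B
      using disj[of D B] disj[of E B] that assms(2,3) by blast
    then show ?thesis using that disj unfolding merge_def disjnt_def by (metis Diff_iff Int_commute insert_iff)
  qed
  show "{} \<notin> merge x D E" using assms partition_onD3[OF assms(1)] by (auto simp: merge_def)
qed

section \<open>Blocks of noncrossing partitions and labeled merges\<close>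

context
  fixes n :: nat
begin

lemma NC_partition: "x \<in> NC n \<Longrightarrow> partition_on {1..n} x"
  by (simp add: NC_def)

lemma block_ne: "x \<in> NC n \<Longrightarrow> B \<in> x \<Longrightarrow> B \<noteq> {}"
  using NC_partition[of x] partition_onD3 by blast

lemma block_subset: "x \<in> NC n \<Longrightarrow> B \<in> x \<Longrightarrow> B \<subseteq> {1..n}"
  using NC_partition[of x] partition_onD1 by blast

lemma block_finite: "x \<in> NC n \<Longrightarrow> B \<in> x \<Longrightarrow> finite B"
  using finite_subset[OF block_subset] by simp

lemma block_eq: "x \<in> NC n \<Longrightarrow> B \<in> x \<Longrightarrow> C \<in> x \<Longrightarrow> e \<in> B \<Longrightarrow> e \<in> C \<Longrightarrow> B = C"
  using partition_onD2[OF NC_partition[of x]] disjointD[of x B C] by blast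

lemma block_cover: "x \<in> NC n \<Longrightarrow> y \<in> NC n \<Longrightarrow> B \<in> x \<Longrightarrow> e \<in> B \<Longrightarrow> \<exists>C\<in>y. e \<in> C"
  using block_subset[of x B] partition_onD1[OF NC_partition[of y]] by blast

lemma NC_finite_elem: "x \<in> NC n \<Longrightarrow> finite x"
  using NC_partition[of x] finite_elements by blast

lemma finite_NC: "finite (NC n)"
proof (rule finite_subset)
  show "NC n \<subseteq> Pow (Pow {1..n})" using block_subset by blast
qed simp

lemma block_not_crosses: "x \<in> NC n \<Longrightarrow> B \<in> x \<Longrightarrow> C \<in> x \<Longrightarrow> B \<noteq> C \<Longrightarrow> \<not> crosses B C"
  by (auto simp: NC_def noncrossing_iff)

lemma refines_block:
  assumes "x \<in> NC n" "y \<in> NC n" "refines x y" "A \<in> x" "C \<in> y" "e \<in> A" "e \<in> C"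
  shows "A \<subseteq> C"
  using assms block_eq[of y] unfolding refines_def by (metis subsetD)

lemma Un_notin:
  assumes "x \<in> NC n" "D \<in> x" "E \<in> x" "D \<noteq> E"
  shows "D \<union> E \<notin> x"
proof
  assume U: "D \<union> E \<in> x"
  obtain d e where "d \<in> D" "e \<in> E" using block_ne assms by blast
  then have "D = D \<union> E" "E = D \<union> E" using block_eq[OF assms(1) _ U] assms by blast+
  then show False using assms(4) by simp
qed

lemma merge_card:
  assumes "x \<in> NC n" "D \<in> x" "E \<in> x" "D \<noteq> E"
  shows "card x = Suc (card (merge x D E))"
proof -
  note fin = NC_finite_elem[OF assms(1)]
  have "card (merge x D E) = Suc (card (x - {D, E}))"
    unfolding merge_def using fin Un_notin[OF assms] by (intro card_insert_disjoint) auto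
  moreover have "card (x - {D, E}) = card x - card {D, E}" "card {D, E} \<le> card x"
    using assms fin by (intro card_Diff_subset card_mono; simp)+
  ultimately show ?thesis using assms(4) by simp
qed

text \<open>Sets inside different blocks of the noncrossing \<open>y\<close> cannot cross, so only
  blocks \<open>G\<close> within the y-block of \<open>D \<union> E\<close> have to be
  checked.\<close>

lemma merge_NC:
  assumes "x \<in> NC n" "y \<in> NC n" "D \<in> x" "E \<in> x" "refines (merge x D E) y"
    and "\<And>G C. \<lbrakk>G \<in> x; G \<noteq> D; G \<noteq> E; C \<in> y; D \<union> E \<union> G \<subseteq> C\<rbrakk>
           \<Longrightarrow> \<not> crosses (D \<union> E) G \<and> \<not> crosses G (D \<union> E)"
  shows "merge x D E \<in> NC n"
proof -
  have *: "\<not> crosses (D \<union> E) G \<and> \<not> crosses G (D \<union> E)" if G: "G \<in> x" "G \<noteq> D" "G \<noteq> E" for G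
  proof -
    obtain C1 C2 where C: "C1 \<in> y" "D \<union> E \<subseteq> C1" "C2 \<in> y" "G \<subseteq> C2"
      using assms(5)[unfolded refines_def, rule_format, of "D \<union> E"]
        assms(5)[unfolded refines_def, rule_format, of G] G unfolding merge_def by blast
    show ?thesis
    proof (cases "C1 = C2")
      case False
      then have "\<not> crosses C1 C2" "\<not> crosses C2 C1" using C block_not_crosses[OF assms(2)] by auto
      then show ?thesis using C crosses_mono by blast
    qed (use assms(6)[OF G C(1)] C in auto)
  qed
  have "noncrossing (merge x D E)"
    unfolding noncrossing_iff
  proof (intro ballI impI)
    fix B C assume "B \<in> merge x D E" "C \<in> merge x D E" "B \<noteq> C"
    then show "\<not> crosses B C"
      using * block_not_crosses[OF assms(1)] unfolding merge_def by blast
  qed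
  then show ?thesis using merge_partition[OF NC_partition[OF assms(1)] assms(3,4)] by (simp add: NC_def)
qed

text \<open>The working description of a cover with label \<open>a\<close>;
  \<open>covers_NC_iff\<close> and \<open>nc_step_label\<close> justify it.\<close>

definition nc_step :: "nat set set \<Rightarrow> nat \<Rightarrow> nat set set \<Rightarrow> bool" where
  "nc_step x a y \<longleftrightarrow> x \<in> NC n \<and> y \<in> NC n \<and> (\<exists>D\<in>x. \<exists>E\<in>x. hooks D E a \<and> y = merge x D E)"

lemma hooks_neq: "hooks D E a \<Longrightarrow> D \<noteq> E"
  by (auto simp: hooks_def)

lemma nc_step_card: "nc_step x a y \<Longrightarrow> card x = Suc (card y)"
  unfolding nc_step_def using merge_card hooks_neq by blast

lemma nc_step_refines: "nc_step x a y \<Longrightarrow> refines x y"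
  unfolding nc_step_def using refines_merge by blast

lemma nc_step_label:
  assumes "nc_step x a y"
  shows "nc_label x y = a"
proof -
  obtain D E where x: "x \<in> NC n" and DE: "D \<in> x" "E \<in> x" "hooks D E a" "y = merge x D E"
    using assms by (auto simp: nc_step_def)
  note ne = hooks_neq[OF DE(3)]
  have fin: "finite D" "finite E" "D \<noteq> {}" "E \<noteq> {}" using x DE block_finite block_ne by auto
  note h = hooks_Min_less[OF DE(3) fin(1,2,4)]
  have "x - y = {D, E}" using Un_notin[OF x DE(1,2) ne] DE by (auto simp: merge_def)
  moreover have "Max (Min ` {D, E}) = Min E" using h(1) by simp
  moreover have "(THE B. B \<in> {D, E} \<and> Min B = Min E) = E" using h(1) by (intro the_equality) auto
  moreover have "(THE B. B \<in> {D, E} \<and> B \<noteq> E) = D" using ne by (intro the_equality) auto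
  ultimately show ?thesis by (simp add: nc_label_def h(2))
qed

text \<open>Splitting a block can only create a crossing between its two parts, and
  \<open>hooks\<close> excludes this.\<close>

lemma split_step:
  assumes y: "y \<in> NC n" "C \<in> y" and E: "E \<subseteq> C" "E \<noteq> {}" and h: "hooks (C - E) E b"
  shows "nc_step (insert (C - E) (insert E (y - {C}))) b y" (is "nc_step ?z b y")
proof -
  let ?D = "C - E"
  have D: "?D \<noteq> {}" using h by (auto simp: hooks_def)
  have sub: "\<exists>B'\<in>y. B \<subseteq> B'" if "B \<in> ?z" for B using that y E by blast
  have nin: "?D \<notin> y" "E \<notin> y"
    using block_eq[OF y(1), of _ C] y(2) D E by blast+
  have "partition_on {1..n} ?z"
  proof (rule partition_onI)
    show "\<Union> ?z = {1..n}" using partition_onD1[OF NC_partition[OF y(1)]] y E by blast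
    show "disjnt p q" if "p \<in> ?z" "q \<in> ?z" "p \<noteq> q" for p q
      using that block_eq[OF y(1)] y(2) E unfolding disjnt_def by blast
    show "{} \<notin> ?z" using D E block_ne[OF y(1)] by blast
  qed
  moreover have "noncrossing ?z"
    unfolding noncrossing_iff
  proof (intro ballI impI)
    fix A B assume AB: "A \<in> ?z" "B \<in> ?z" "A \<noteq> B"
    then consider "A \<in> {?D, E} \<and> B \<in> {?D, E}" | A' B' where "A' \<in> y" "B' \<in> y" "A' \<noteq> B'" "A \<subseteq> A'" "B \<subseteq> B'"
      using y(2) E(1) by blast
    then show "\<not> crosses A B"
    proof cases
      case 1
      then show ?thesis using AB(3) hooks_not_crosses[OF h] by blast
    next
      case 2
      then show ?thesis using block_not_crosses[OF y(1)] crosses_mono by blast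
    qed
  qed
  ultimately have "?z \<in> NC n" by (simp add: NC_def)
  moreover have "y = merge ?z ?D E"
    using nin y(2) E by (auto simp: merge_def Un_absorb2)
  ultimately show ?thesis using y(1) h by (auto simp: nc_step_def)
qed

section \<open>Gaps and splitting at the largest gap\<close>

text \<open>The candidates for the labels of the increasing chain from x to y: a runs over the predecessors,
  in the y-blocks C, of the minima of those x-blocks A that do not contain the minimum of C.\<close>
definition gaps :: "nat set set \<Rightarrow> nat set set \<Rightarrow> nat set" where
  "gaps x y = {a. \<exists>C\<in>y. \<exists>A\<in>x. A \<subseteq> C \<and> a \<in> C \<and> (\<forall>e\<in>A. a < e) \<and> (\<forall>c\<in>C. c \<le> a \<or> (\<exists>e\<in>A. e \<le> c))}"

text \<open>The witness is the largest element of \<open>C\<close> below all of \<open>A\<close>.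
  The bound \<open>c \<le> a\<close> is used to produce gaps larger than a given one.\<close>

lemma gap_exists:
  fixes C A :: "nat set"
  assumes "finite C" "c \<in> C" "\<forall>e\<in>A. c < e"
  shows "\<exists>a\<in>C. c \<le> a \<and> (\<forall>e\<in>A. a < e) \<and> (\<forall>c\<in>C. c \<le> a \<or> (\<exists>e\<in>A. e \<le> c))"
proof -
  let ?S = "{c\<in>C. \<forall>e\<in>A. c < e}"
  have S: "finite ?S" "c \<in> ?S" using assms by auto
  have "Max ?S \<in> ?S" using S by (intro Max_in) auto
  moreover have "c' \<le> Max ?S \<or> (\<exists>e\<in>A. e \<le> c')" if "c' \<in> C" for c'
    using that S(1) by (cases "c' \<in> ?S") (auto simp: not_less)
  ultimately show ?thesis using S by (intro bexI[of _ "Max ?S"]) auto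
qed

lemma gaps_finite: "y \<in> NC n \<Longrightarrow> finite (gaps x y)"
  by (rule finite_subset[of _ "{1..n}"]) (use block_subset in \<open>auto simp: gaps_def\<close>)

lemma gaps_self: "x \<in> NC n \<Longrightarrow> gaps x x = {}"
proof (rule ccontr)
  assume x: "x \<in> NC n" "gaps x x \<noteq> {}"
  then obtain a C A where h: "C \<in> x" "A \<in> x" "A \<subseteq> C" "a \<in> C" "\<forall>e\<in>A. a < e"
    by (auto simp: gaps_def)
  then have "A = C" using block_eq[OF x(1), of A C] block_ne[OF x(1), of A] by blast
  then show False using h by auto
qed

text \<open>Partitions of one set with \<open>y \<subseteq> x\<close> are equal, so some y-block
  \<open>C\<close> is not an x-block. An x-block of \<open>C\<close> that misses
  \<open>Min C\<close> then has a predecessor in \<open>C\<close>.\<close>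

lemma gaps_nonempty:
  assumes x: "x \<in> NC n" and y: "y \<in> NC n" and r: "refines x y" and ne: "x \<noteq> y"
  shows "gaps x y \<noteq> {}"
proof -
  have "\<exists>C\<in>y. C \<notin> x"
  proof (rule ccontr)
    assume "\<not> ?thesis"
    then have "y \<subseteq> x" by blast
    moreover have "A \<in> y" if A: "A \<in> x" for A
    proof -
      obtain e where e: "e \<in> A" using block_ne[OF x A] by blast
      then obtain C where C: "C \<in> y" "e \<in> C" using block_cover[OF x y A] by blast
      then have "A = C" using block_eq[OF x A _ e, of C] \<open>y \<subseteq> x\<close> by blast
      then show ?thesis using C by simp
    qed
    ultimately have "x = y" by blast
    then show False using ne by simp
  qed
  then obtain C where C: "C \<in> y" "C \<notin> x" by blast
  have fin: "finite C" "C \<noteq> {}" using C y block_finite block_ne by auto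
  obtain A0 where A0: "A0 \<in> x" "Min C \<in> A0" using block_cover[OF y x C(1) Min_in[OF fin]] by blast
  have "A0 \<subseteq> C" using refines_block[OF x y r A0(1) C(1) A0(2) Min_in[OF fin]] .
  moreover have "A0 \<noteq> C" using A0(1) C(2) by metis
  ultimately obtain c where c: "c \<in> C" "c \<notin> A0" by blast
  then obtain A where A: "A \<in> x" "c \<in> A" using block_cover[OF y x C(1)] by blast
  have "A \<subseteq> C" using refines_block[OF x y r A(1) C(1) A(2) c(1)] .
  moreover have "Min C \<notin> A" using block_eq[OF x A(1) A0(1)] A0 c A by blast
  ultimately have "\<forall>e\<in>A. Min C < e" using fin by (metis Min_le nat_less_le subsetD)
  from gap_exists[OF fin(1) Min_in[OF fin] this] show ?thesis
    using C A \<open>A \<subseteq> C\<close> unfolding gaps_def by blast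
qed

text \<open>The x-block \<open>A\<close> that follows the largest gap \<open>b\<close> is split off
  from its y-block \<open>C\<close>. Maximality of \<open>b\<close> ensures that no element of
  \<open>C - A\<close> lies between elements of \<open>A\<close>, so the split is a legal merge with
  label \<open>b\<close>.\<close>

lemma split_max_gap:
  assumes x: "x \<in> NC n" and y: "y \<in> NC n" and r: "refines x y"
    and b: "b \<in> gaps x y" and max: "\<forall>a\<in>gaps x y. a \<le> b"
  shows "\<exists>z. nc_step z b y \<and> refines x z \<and> (\<forall>a\<in>gaps x z. a < b)"
proof -
  obtain C A where C: "C \<in> y" and A: "A \<in> x" "A \<subseteq> C" and bA: "b \<in> C" "\<forall>e\<in>A. b < e"
    "\<forall>c\<in>C. c \<le> b \<or> (\<exists>e\<in>A. e \<le> c)"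
    using b by (auto simp: gaps_def)
  have finC: "finite C" using block_finite[OF y C] .
  \<comment> \<open>An x-block of \<open>C\<close> beyond some element of \<open>A\<close> would
    have a predecessor above \<open>b\<close>, against maximality.\<close>
  have later: False if A': "A' \<in> x" "A' \<subseteq> C" "e \<in> A" "\<forall>e'\<in>A'. e < e'" for A' e
  proof -
    have "e \<in> C" using A'(3) A(2) by blast
    from gap_exists[OF finC this A'(4)] obtain a where
      a: "a \<in> C" "e \<le> a" "\<forall>e\<in>A'. a < e" "\<forall>c\<in>C. c \<le> a \<or> (\<exists>e\<in>A'. e \<le> c)" by blast
    then have "a \<in> gaps x y" using C A' by (auto simp: gaps_def)
    then show False using max a bA(2) A'(3) by fastforce
  qed
  have h: "hooks (C - A) A b"
    unfolding hooks_def
  proof (intro conjI ballI)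
    fix c assume c: "c \<in> C - A"
    show "c \<le> b \<or> (\<forall>e\<in>A. e < c)"
    proof (rule ccontr)
      assume "\<not> ?thesis"
      then obtain e1 e2 where e: "e1 \<in> A" "e1 \<le> c" "e2 \<in> A" "c \<le> e2" using bA(3) c by (auto simp: not_less)
      then have lt: "e1 < c" "c < e2" using c by (auto simp: nat_less_le)
      obtain A' where A': "A' \<in> x" "c \<in> A'" using block_cover[OF y x C] c by blast
      then have sub: "A' \<subseteq> C" using refines_block[OF x y r A'(1) C A'(2)] c by blast
      have "A' \<noteq> A" using A' c by blast
      then have nc: "\<not> crosses A' A" "\<not> crosses A A'" using block_not_crosses[OF x] A A' by auto
      \<comment> \<open>The x-block \<open>A'\<close> of a point \<open>c\<close> between
        \<open>e1\<close> and \<open>e2\<close> cannot reach below \<open>e1\<close> without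
        crossing \<open>A\<close>; so it lies beyond \<open>e1\<close>, which \<open>later\<close>
        forbids.\<close>
      have "\<forall>e'\<in>A'. e1 < e'"
      proof (rule ccontr)
        assume "\<not> ?thesis"
        then obtain e' where "e' \<in> A'" "e' \<le> e1" by (auto simp: not_less)
        moreover then have "e' \<noteq> e1" using block_eq[OF x A(1) A'(1)] \<open>A' \<noteq> A\<close> e by blast
        ultimately have "crosses A' A" using lt e A' unfolding crosses_def by (metis nat_less_le)
        then show False using nc by blast
      qed
      then show False using later[OF A'(1) sub e(1)] by blast
    qed
  qed (use bA in auto)
  let ?z = "insert (C - A) (insert A (y - {C}))"
  have st: "nc_step ?z b y" using split_step[OF y C A(2) block_ne[OF x A(1)] h] .
  then have z: "?z \<in> NC n" by (simp add: nc_step_def)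
  have rz: "refines x ?z"
    unfolding refines_def
  proof
    fix B assume B: "B \<in> x"
    then obtain C' where C': "C' \<in> y" "B \<subseteq> C'" using r unfolding refines_def by blast
    show "\<exists>C\<in>?z. B \<subseteq> C"
    proof (cases "C' = C \<and> B \<noteq> A")
      case True
      then have "B \<subseteq> C - A" using C' block_eq[OF x B A(1)] by blast
      then show ?thesis by blast
    qed (use C' in blast)
  qed
  \<comment> \<open>The new block \<open>A\<close> contains no gap, as it is an x-block. A gap in
    \<open>C - A\<close> is at most the corresponding gap in \<open>C\<close>. A gap elsewhere is a
    gap of \<open>y\<close> in a block not containing \<open>b\<close>.\<close>
  have "a < b" if "a \<in> gaps x ?z" for a
  proof -
    obtain C' A' where C': "C' \<in> ?z" and A': "A' \<in> x" "A' \<subseteq> C'" and aA: "a \<in> C'" "\<forall>e\<in>A'. a < e"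
      "\<forall>c\<in>C'. c \<le> a \<or> (\<exists>e\<in>A'. e \<le> c)"
      using \<open>a \<in> gaps x ?z\<close> by (auto simp: gaps_def)
    from C' consider "C' = A" | "C' = C - A" | "C' \<in> y" "C' \<noteq> C" by blast
    then show ?thesis
    proof cases
      case 1
      then have "A' = A" using A' block_eq[OF x A'(1) A(1)] block_ne[OF x A'(1)] by blast
      then show ?thesis using 1 aA by auto
    next
      case 2
      then have "a \<in> C" using aA(1) by blast
      from gap_exists[OF finC this aA(2)] obtain a' where
        a': "a' \<in> C" "a \<le> a'" "\<forall>e\<in>A'. a' < e" "\<forall>c\<in>C. c \<le> a' \<or> (\<exists>e\<in>A'. e \<le> c)"
        by blast
      have "A' \<subseteq> C" using A'(2) 2 by blast
      then have "a' \<in> gaps x y" using a' C A'(1) unfolding gaps_def by blast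
      then have a'b: "a' \<le> b" using max by blast
      \<comment> \<open>If \<open>b\<close> preceded \<open>A'\<close> as well, the minima of
        \<open>A\<close> and \<open>A'\<close> would both be the successor of \<open>b\<close> in
        \<open>C\<close>, but \<open>A\<close> and \<open>A'\<close> are disjoint.\<close>
      have "a \<noteq> b"
      proof
        assume "a = b"
        then have eq: "a' = b" using a' a'b by simp
        have A'C: "A' \<subseteq> C" "A' \<inter> A = {}" using A' 2 by auto
        obtain e where e: "e \<in> A" using block_ne[OF x A(1)] by blast
        obtain e' where e': "e' \<in> A'" using block_ne[OF x A'(1)] by blast
        have fin: "finite A" "finite A'" "A \<noteq> {}" "A' \<noteq> {}" using block_finite[OF x] A A' e e' by auto
        have "Min A \<noteq> Min A'" using A'C Min_in fin by (metis disjoint_iff)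
        moreover have "Min A' \<le> Min A"
          using a'(4) eq bA(2) A fin Min_in[OF fin(1,3)] by (meson Min_le leD order_trans subsetD)
        moreover have "Min A \<le> Min A'"
          using bA(3) a'(3) eq A'C fin Min_in[OF fin(2,4)] by (meson Min_le leD order_trans subsetD)
        ultimately show False by simp
      qed
      then show ?thesis using a' a'b by simp
    next
      case 3
      then have "a \<in> gaps x y" using A' aA unfolding gaps_def by blast
      moreover have "a \<noteq> b" using block_eq[OF y C 3(1)] 3 aA bA by blast
      ultimately show ?thesis using max by (simp add: nat_less_le)
    qed
  qed
  then show ?thesis using st rz by blast
qed

text \<open>Besides building increasing chains from the top, this supplies the intermediate elements
  that identify the covers and make the number of blocks strictly monotone.\<close>

lemma step_below:
  assumes "x \<in> NC n" "y \<in> NC n" "refines x y" "x \<noteq> y"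
  shows "\<exists>z b. nc_step z b y \<and> refines x z \<and> (\<forall>a\<in>gaps x z. a < b)"
proof -
  have "finite (gaps x y)" "gaps x y \<noteq> {}" using gaps_finite gaps_nonempty assms by auto
  then show ?thesis using split_max_gap[OF assms(1-3) Max_in] Max_ge by meson
qed

section \<open>Block counts, covers and the growth of gaps\<close>

lemma refines_card:
  assumes "x \<in> NC n" "y \<in> NC n" "refines x y"
  shows "card y \<le> card x"
proof -
  have "\<exists>A\<in>x. A \<subseteq> C" if C: "C \<in> y" for C
  proof -
    obtain e where e: "e \<in> C" using block_ne[OF assms(2) C] by blast
    then obtain A where A: "A \<in> x" "e \<in> A" using block_cover[OF assms(2,1) C] by blast
    then show ?thesis using refines_block[OF assms A(1) C A(2) e] by blast
  qed
  then obtain f where f: "\<And>C. C \<in> y \<Longrightarrow> f C \<in> x \<and> f C \<subseteq> C" by metis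
  have "inj_on f y"
    using f block_eq[OF assms(2)] block_ne[OF assms(1)] by (intro inj_onI) (metis ex_in_conv subsetD)
  then show ?thesis using f NC_finite_elem[OF assms(1)] by (intro card_inj_on_le) auto
qed

lemma refines_card_less:
  assumes "x \<in> NC n" "y \<in> NC n" "refines x y" "x \<noteq> y"
  shows "card y < card x"
proof -
  obtain z b where z: "nc_step z b y" "refines x z" using step_below[OF assms] by blast
  then have "card z \<le> card x" using refines_card assms(1) by (simp add: nc_step_def)
  then show ?thesis using nc_step_card[OF z(1)] by simp
qed

lemma NC_antisym: "x \<in> NC n \<Longrightarrow> y \<in> NC n \<Longrightarrow> refines x y \<Longrightarrow> refines y x \<Longrightarrow> x = y"
  using refines_card_less refines_card by (meson not_le)

text \<open>A cover leaves no room for the element \<open>z\<close> of \<open>step_below\<close>, so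
  \<open>z = x\<close>. Conversely, a merge lowers the number of blocks by one, and this number is
  strictly monotone.\<close>

lemma covers_NC_iff: "covers (NC n) refines x y \<longleftrightarrow> (\<exists>a. nc_step x a y)"
proof
  assume cov: "covers (NC n) refines x y"
  then obtain z b where z: "nc_step z b y" "refines x z" using step_below unfolding covers_def by meson
  then have "z \<noteq> y" "z \<in> NC n" "refines z y"
    using nc_step_card[OF z(1)] nc_step_refines[OF z(1)] by (auto simp: nc_step_def)
  then have "z = x" using cov z unfolding covers_def by blast
  then show "\<exists>a. nc_step x a y" using z by blast
next
  assume "\<exists>a. nc_step x a y"
  then obtain a where a: "nc_step x a y" ..
  then have NC: "x \<in> NC n" "y \<in> NC n" and c: "card x = Suc (card y)" and "refines x y"
    using nc_step_card[OF a] nc_step_refines[OF a] by (simp_all add: nc_step_def)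
  moreover have "z = x \<or> z = y" if z: "z \<in> NC n" "refines x z" "refines z y" for z
    using refines_card_less[OF NC(1) z(1,2)] refines_card_less[OF z(1) NC(2) z(3)] c by fastforce
  ultimately show "covers (NC n) refines x y" unfolding covers_def by auto
qed

lemma nc_step_of_cover: "covers (NC n) refines x y \<Longrightarrow> nc_step x (nc_label x y) y"
  using covers_NC_iff nc_step_label by blast

text \<open>As all labels below b are used up, E must be an x-block, and no x-block of D can directly follow E.\<close>
lemma gaps_step:
  assumes r: "refines x z" and x: "x \<in> NC n" and st: "nc_step z b y" and less: "\<forall>a\<in>gaps x z. a < b"
  shows "gaps x y = insert b (gaps x z)"
proof -
  obtain D E where z: "z \<in> NC n" and y: "y \<in> NC n" and DE: "D \<in> z" "E \<in> z" and h: "hooks D E b"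
    and yeq: "y = insert (D \<union> E) (z - {D, E})"
    using st by (auto simp: nc_step_def merge_def)
  have fin: "finite E" "E \<noteq> {}" using block_finite[OF z] block_ne[OF z] DE by auto
  have hb: "b \<in> D" "\<And>e. e \<in> E \<Longrightarrow> b < e" "\<And>d e. d \<in> D \<Longrightarrow> e \<in> E \<Longrightarrow> b < d \<Longrightarrow> e < d"
    using hooksD[OF h] by blast+
  have Ex: "E \<in> x"
  proof (rule ccontr)
    assume "E \<notin> x"
    obtain A0 where A0: "A0 \<in> x" "Min E \<in> A0" using block_cover[OF z x DE(2) Min_in[OF fin]] by blast
    have "A0 \<subseteq> E" using refines_block[OF x z r A0(1) DE(2) A0(2) Min_in[OF fin]] .
    moreover have "A0 \<noteq> E" using A0(1) \<open>E \<notin> x\<close> by metis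
    ultimately obtain c where c: "c \<in> E" "c \<notin> A0" by blast
    then obtain A where A: "A \<in> x" "c \<in> A" using block_cover[OF z x DE(2)] by blast
    have sub: "A \<subseteq> E" using refines_block[OF x z r A(1) DE(2) A(2) c(1)] .
    moreover have "Min E \<notin> A" using block_eq[OF x A(1) A0(1)] A0 c A by blast
    ultimately have "\<forall>e\<in>A. Min E < e" using fin by (metis Min_le nat_less_le subsetD)
    \<comment> \<open>Such an \<open>A\<close> has a predecessor inside \<open>E\<close>, which is a
      gap above \<open>b\<close>.\<close>
    from gap_exists[OF fin(1) Min_in[OF fin] this]
    obtain a where "a \<in> E" "a \<in> gaps x z" using A DE sub unfolding gaps_def by blast
    then show False using less hb(2) by fastforce
  qed
  have "b \<in> gaps x y"
  proof -
    have "c \<le> b \<or> (\<exists>e\<in>E. e \<le> c)" if "c \<in> D \<union> E" for c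
    proof (cases "c \<in> E")
      case False
      obtain e where "e \<in> E" using fin(2) by blast
      then show ?thesis using hb(3)[of c e] that False by (meson UnE less_imp_le not_le)
    qed blast
    moreover have "D \<union> E \<in> y" "E \<subseteq> D \<union> E" "b \<in> D \<union> E" using yeq hb(1) by auto
    ultimately show ?thesis using hb(2) Ex unfolding gaps_def by blast
  qed
  moreover have "a \<in> gaps x y" if a: "a \<in> gaps x z" for a
  proof -
    obtain C A where C: "C \<in> z" and A: "A \<in> x" "A \<subseteq> C" and aA: "a \<in> C" "\<forall>e\<in>A. a < e"
      "\<forall>c\<in>C. c \<le> a \<or> (\<exists>e\<in>A. e \<le> c)" using a unfolding gaps_def by blast
    have ab: "a < b" using less a by blast
    then have "C \<noteq> E" using aA hb(2) by force
    show ?thesis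
    proof (cases "C = D")
      case True
      \<comment> \<open>As \<open>b\<close> lies in \<open>D\<close> above \<open>a\<close>, some
        element of \<open>A\<close> is at most \<open>b\<close>; the added elements of
        \<open>E\<close> are larger and do not come between \<open>a\<close> and
        \<open>A\<close>.\<close>
      then obtain e where e: "e \<in> A" "e \<le> b" using aA(3) hb(1) ab by (meson leD)
      then have "\<forall>c\<in>D \<union> E. c \<le> a \<or> (\<exists>e\<in>A. e \<le> c)"
        using aA(3) True hb(2) by (metis UnE less_imp_le order_trans)
      moreover have "D \<union> E \<in> y" "A \<subseteq> D \<union> E" "a \<in> D \<union> E" using yeq A(2) aA(1) True by auto
      ultimately show ?thesis unfolding gaps_def using A(1) aA(2) by blast
    next
      case False
      then have "C \<in> y" using \<open>C \<noteq> E\<close> C yeq by blast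
      then show ?thesis unfolding gaps_def using A aA by blast
    qed
  qed
  moreover have "a \<in> gaps x z" if a: "a \<in> gaps x y" "a \<noteq> b" for a
  proof -
    obtain C A where C: "C \<in> y" and A: "A \<in> x" "A \<subseteq> C" and aA: "a \<in> C" "\<forall>e\<in>A. a < e"
      "\<forall>c\<in>C. c \<le> a \<or> (\<exists>e\<in>A. e \<le> c)" using a unfolding gaps_def by blast
    show ?thesis
    proof (cases "C \<in> z")
      case True
      then show ?thesis unfolding gaps_def using A aA by blast
    next
      case False
      then have Ceq: "C = D \<union> E" using C yeq by blast
      \<comment> \<open>The predecessor of \<open>E\<close> in \<open>D \<union> E\<close> is
        \<open>b\<close>, which differs from \<open>a\<close>.\<close>
      have "A \<noteq> E"
      proof
        assume "A = E"
        then have "b \<le> a" using aA(3) hb Ceq by (metis UnI1 leD)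
        moreover have "a \<notin> E" using aA(2) \<open>A = E\<close> by blast
        ultimately have "b < a" "a \<in> D" using a aA(1) Ceq by auto
        then show False using hb(3) aA(2) \<open>A = E\<close> fin(2) by (metis ex_in_conv less_asym)
      qed
      then have "A \<inter> E = {}" using block_eq[OF x A(1) Ex] by blast
      then have AD: "A \<subseteq> D" using A Ceq by blast
      show ?thesis
      proof (cases "a \<in> D")
        case True
        moreover have "\<forall>c\<in>D. c \<le> a \<or> (\<exists>e\<in>A. e \<le> c)" using aA(3) Ceq by blast
        ultimately show ?thesis unfolding gaps_def using A(1) aA(2) DE(1) AD by blast
      next
        case False
        \<comment> \<open>If \<open>A\<close> followed an element of \<open>E\<close>, then without
          \<open>E\<close> its predecessor in \<open>D\<close> would be \<open>b\<close>, so
          \<open>b\<close> would already be a gap of \<open>z\<close>.\<close>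
        then have aE: "a \<in> E" using aA Ceq by blast
        have "\<forall>e\<in>A. b < e" using hb(2)[OF aE] aA(2) by (meson less_trans)
        moreover have "c \<le> b \<or> (\<exists>e\<in>A. e \<le> c)" if c: "c \<in> D" for c
        proof (cases "c \<le> a")
          case True
          then have "\<not> b < c" using hb(3)[OF c aE] by auto
          then show ?thesis by simp
        qed (use c aA Ceq in blast)
        ultimately have "b \<in> gaps x z" unfolding gaps_def using DE A AD hb(1) by blast
        then show ?thesis using less by blast
      qed
    qed
  qed
  ultimately show ?thesis by blast
qed

section \<open>The rank two switching property\<close>

lemma merge_merge:
  assumes "x \<in> NC n" "A \<in> x" "B \<in> x" "A \<noteq> B"
  shows "merge (merge x A B) (A \<union> B) C = insert (A \<union> B \<union> C) (x - {A, B, C})"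
  using Un_notin[OF assms] by (auto simp: merge_def)

text \<open>Let the steps merge \<open>F\<close> with \<open>G\<close>, then \<open>D\<close> with
  \<open>E\<close>. As \<open>a < b\<close>, \<open>E\<close> is not the block just formed. If
  \<open>D\<close> is not either, the merges commute. If \<open>D = F \<union> G\<close>, then
  \<open>E\<close> is first attached to whichever of \<open>F\<close> and \<open>G\<close> contains
  \<open>b\<close>, and the third block is merged afterwards.\<close>

lemma nc_switch:
  assumes s1: "nc_step x a z" and s2: "nc_step z b y" and ab: "a < b"
  shows "\<exists>z'. nc_step x b z' \<and> nc_step z' a y"
proof -
  obtain F G where x: "x \<in> NC n" and z: "z \<in> NC n" and FG: "F \<in> x" "G \<in> x" "hooks F G a"
    "z = merge x F G" using s1 by (auto simp: nc_step_def)
  obtain D E where y: "y \<in> NC n" and DE: "D \<in> z" "E \<in> z" "hooks D E b"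
    "y = merge z D E" using s2 by (auto simp: nc_step_def)
  note FGne = hooks_neq[OF FG(3)] and DEne = hooks_neq[OF DE(3)]
  have "E \<noteq> F \<union> G"
  proof
    assume "E = F \<union> G"
    \<comment> \<open>Here \<open>E\<close> would contain \<open>a\<close>, while \<open>b\<close>
      lies below all of \<open>E\<close>.\<close>
    then have "b < a" using DE(3) FG(3) unfolding hooks_def by blast
    then show False using ab by simp
  qed
  then have E: "E \<in> x" "E \<noteq> F" "E \<noteq> G" using DE(2) FG(4) by (auto simp: merge_def)
  show ?thesis
  proof (cases "D = F \<union> G")
    case D: True
    have yeq: "y = insert (F \<union> G \<union> E) (x - {F, G, E})"
      unfolding DE(4) FG(4) D using merge_merge[OF x FG(1,2) FGne] .
    have hFG: "a \<in> F" "\<And>g. g \<in> G \<Longrightarrow> a < g" "\<And>f g. f \<in> F \<Longrightarrow> g \<in> G \<Longrightarrow> a < f \<Longrightarrow> g < f"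
      using hooksD[OF FG(3)] by blast+
    have hDE: "b \<in> F \<union> G" "\<And>e. e \<in> E \<Longrightarrow> b < e" "\<And>d e. d \<in> F \<union> G \<Longrightarrow> e \<in> E \<Longrightarrow> b < d \<Longrightarrow> e < d"
      using hooksD[OF DE(3)[unfolded D]] by blast+
    \<comment> \<open>Common part of both cases: \<open>K\<close> and \<open>L\<close> are merged
      first, and \<open>M\<close>, the remaining one of the three blocks, is \<open>G\<close> or
      \<open>F\<close>, whence the disjunction.\<close>
    have *: "\<exists>z'. nc_step x b z' \<and> nc_step z' a y"
      if KL: "K \<in> x" "L \<in> x" "M \<in> x" "{K, L, M} = {F, G, E}" "hooks K L b"
        and hk: "hooks (K \<union> L) M a \<or> hooks M (K \<union> L) a" for K L M
    proof -
      let ?z = "merge x K L"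
      note KLne = hooks_neq[OF KL(5)]
      have yeq': "y = merge ?z (K \<union> L) M"
      proof -
        have "\<Union>{F, G, E} = \<Union>{K, L, M}" using KL(4) by simp
        then have "F \<union> G \<union> E = K \<union> L \<union> M" by (simp add: Un_assoc)
        with yeq have "y = insert (K \<union> L \<union> M) (x - {K, L, M})" unfolding KL(4) by simp
        then show ?thesis using merge_merge[OF x KL(1,2) KLne, of M] by (simp only:)
      qed
      have "card {K, L, M} = 3" unfolding KL(4) using FGne E by auto
      then have MKL: "M \<noteq> K" "M \<noteq> L" by (auto simp: card_insert_if split: if_splits)
      have "?z \<in> NC n"
      proof (rule merge_NC[OF x y KL(1,2)])
        show "refines ?z y" unfolding yeq' by (rule refines_merge)
        fix H C assume H: "H \<in> x" "H \<noteq> K" "H \<noteq> L" "C \<in> y" "K \<union> L \<union> H \<subseteq> C"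
        \<comment> \<open>The y-block of \<open>K \<union> L\<close> consists of \<open>K\<close>,
          \<open>L\<close> and \<open>M\<close>, so only \<open>M\<close> could cross.\<close>
        have "H = M"
        proof (rule ccontr)
          assume "H \<noteq> M"
          then have "H \<notin> {K, L, M}" using H by simp
          then have "H \<in> y" using H(1) yeq unfolding KL(4) by blast
          then have "H = C" using block_eq[OF y, of H C] H block_ne[OF x] by blast
          then have "K \<subseteq> H" using H by blast
          then show False using block_eq[OF x KL(1) H(1)] H block_ne[OF x KL(1)] by blast
        qed
        then show "\<not> crosses (K \<union> L) H \<and> \<not> crosses H (K \<union> L)" using hk hooks_not_crosses by blast
      qed
      moreover have "K \<union> L \<in> ?z" "M \<in> ?z" using MKL KL(3) by (auto simp: merge_def)
      moreover have "y = merge ?z M (K \<union> L)" using yeq' merge_commute by simp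
      ultimately have "nc_step ?z a y" using y hk yeq' unfolding nc_step_def by blast
      moreover have "nc_step x b ?z" using x \<open>?z \<in> NC n\<close> KL unfolding nc_step_def by blast
      ultimately show ?thesis by blast
    qed
    show ?thesis
    proof (cases "b \<in> F")
      case True
      \<comment> \<open>As \<open>b\<close> lies in \<open>F\<close> above \<open>a\<close>, all of
        \<open>G\<close> lies between \<open>a\<close> and \<open>b\<close>, and \<open>E\<close>
        can be attached to \<open>F\<close>.\<close>
      have bG: "g < b" if "g \<in> G" for g using hFG(3)[OF True that ab] .
      have "hooks F E b" using True hDE by (intro hooksI) auto
      moreover have "hooks (F \<union> E) G a"
        using hFG bG hDE(2) by (intro hooksI) (auto intro: less_trans[of _ b])
      ultimately show ?thesis using *[of F E G] FG E by blast
    next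
      case False
      then have bG: "b \<in> G" using hDE(1) by blast
      have "hooks G E b" using bG hDE by (intro hooksI) auto
      moreover have "hooks F (G \<union> E) a"
      proof (rule hooksI)
        fix f e assume fe: "f \<in> F" "e \<in> G \<union> E" "a < f"
        \<comment> \<open>Past \<open>a\<close>, \<open>F\<close> continues only beyond all of
          \<open>G\<close>, hence beyond \<open>b\<close>, and so beyond \<open>E\<close>.\<close>
        then have "b < f" using hFG(3)[OF _ bG] by blast
        then show "e < f" using fe hFG(3) hDE(3)[of f e] by blast
      qed (use hFG hDE(2) ab in \<open>auto intro: less_trans\<close>)
      ultimately show ?thesis using *[of G E F] FG E by blast
    qed
  next
    case D: False
    then have Dx: "D \<in> x" "D \<noteq> F" "D \<noteq> G" using DE(1) FG(4) by (auto simp: merge_def)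
    let ?z = "merge x D E"
    note nin1 = Un_notin[OF x FG(1,2) FGne] and nin2 = Un_notin[OF x Dx(1) E(1) DEne]
    have yeq: "y = merge ?z F G" and yeq': "y = insert (F \<union> G) (insert (D \<union> E) (x - {D, E, F, G}))"
      unfolding DE(4) FG(4) using Dx E FG(1,2) nin1 nin2 by (auto simp: merge_def)
    have "?z \<in> NC n"
    proof (rule merge_NC[OF x y Dx(1) E(1)])
      show "refines ?z y" unfolding yeq by (rule refines_merge)
      fix H C assume H: "H \<in> x" "H \<noteq> D" "H \<noteq> E" "C \<in> y" "D \<union> E \<union> H \<subseteq> C"
      \<comment> \<open>\<open>D \<union> E\<close> is a whole block of \<open>y\<close>, so it
        contains no third x-block.\<close>
      have "D \<union> E \<in> y" using yeq' by blast
      then have "C = D \<union> E" using block_eq[OF y H(4)] H(5) block_ne[OF x Dx(1)] by blast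
      then show "\<not> crosses (D \<union> E) H \<and> \<not> crosses H (D \<union> E)"
        using H block_eq[OF x H(1) Dx(1)] block_eq[OF x H(1) E(1)] block_ne[OF x H(1)] by blast
    qed
    moreover have "F \<in> ?z" "G \<in> ?z" using FG Dx E by (auto simp: merge_def)
    ultimately show ?thesis using x y Dx E FG DE yeq unfolding nc_step_def by blast
  qed
qed

section \<open>Gradedness of \<open>NC n\<close>\<close>

lemma is_poset_NC: "is_poset (NC n) refines"
  unfolding is_poset_def using refines_refl NC_antisym refines_trans by blast

lemma NC_bot_in: "NC_bot n \<in> NC n"
proof -
  have "partition_on {1..n} (NC_bot n)"
    by (rule partition_onI) (auto simp: NC_bot_def)
  moreover have "noncrossing (NC_bot n)"
    by (auto simp: noncrossing_def NC_bot_def)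
  ultimately show ?thesis by (simp add: NC_def)
qed

lemma NC_bot_refines: "x \<in> NC n \<Longrightarrow> refines (NC_bot n) x"
  using partition_onD1[OF NC_partition[of x]] unfolding refines_def NC_bot_def by fast

lemma chain_length_NC:
  "is_sat_chain (NC n) refines c \<Longrightarrow> card (hd c) + 1 = card (last c) + length c"
proof (induction c rule: induct_list012)
  case (3 x y c)
  then show ?case using nc_step_card[OF nc_step_of_cover[of x y]] by simp
qed (simp_all add: is_sat_chain_def)

lemma graded_NC: "graded_with_bottom (NC n) refines (NC_bot n)"
  unfolding graded_with_bottom_def
proof (intro conjI ballI allI impI)
  fix x c d assume "maxchain (NC n) refines (NC_bot n) x c \<and> maxchain (NC n) refines (NC_bot n) x d"
  then show "length c = length d"
    using chain_length_NC[of c] chain_length_NC[of d] by (simp add: maxchain_def)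
qed (use finite_NC is_poset_NC NC_bot_in NC_bot_refines in auto)

section \<open>Label words of increasing chains\<close>

abbreviation "chain x y c \<equiv> maxchain (NC n) refines x y c"
abbreviation "word c \<equiv> label_word nc_label c"

lemma chain_refines: "chain x y c \<Longrightarrow> refines x y"
proof -
  interpret graded_poset "NC n" refines "NC_bot n" by unfold_locales (rule graded_NC)
  show "chain x y c \<Longrightarrow> refines x y" by (rule maxchain_le)
qed

lemma chain_ends: "chain x y c \<Longrightarrow> x \<in> NC n \<and> y \<in> NC n \<and> c \<noteq> []"
  unfolding maxchain_def is_sat_chain_def by (metis hd_in_set last_in_set subsetD)

lemma chain_snoc_iff:
  "c \<noteq> [] \<Longrightarrow> chain x y (c @ [y']) \<longleftrightarrow> y' = y \<and> chain x (last c) c \<and> covers (NC n) refines (last c) y"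
  by (auto simp: maxchain_def is_sat_chain_snoc)

lemma chain_Nil_iff: "chain x y [z] \<longleftrightarrow> x = z \<and> y = z \<and> z \<in> NC n"
  by (auto simp: maxchain_def)

lemma chain_Cons_iff:
  "chain x y (z # z' # c) \<longleftrightarrow> x = z \<and> covers (NC n) refines z z' \<and> chain z' y (z' # c)"
  by (auto simp: maxchain_def)

text \<open>Each label of an increasing chain exceeds the earlier ones, which by induction are the
  gaps so far; so \<open>gaps_step\<close> applies at every cover.\<close>

lemma set_increasing_word:
  "chain x y c \<Longrightarrow> sorted_wrt (<) (word c) \<Longrightarrow> set (word c) = gaps x y"
proof (induction c arbitrary: y rule: rev_induct)
  case (snoc y' c)
  show ?case
  proof (cases "c = []")
    case True
    then show ?thesis using snoc.prems gaps_self by (auto simp: chain_Nil_iff)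
  next
    case False
    let ?z = "last c" and ?b = "nc_label (last c) y"
    have ch: "y' = y" "chain x ?z c" "nc_step ?z ?b y"
      using snoc.prems(1) False nc_step_of_cover by (auto simp: chain_snoc_iff)
    have w: "word (c @ [y']) = word c @ [?b]" using False ch by (simp add: label_word_append)
    have s: "sorted_wrt (<) (word c)" "\<forall>a\<in>set (word c). a < ?b"
      using snoc.prems(2) unfolding w by (auto simp: sorted_wrt_append)
    have IH: "set (word c) = gaps x ?z" using snoc.IH[OF ch(2) s(1)] .
    have "gaps x y = insert ?b (gaps x ?z)"
      using gaps_step[OF chain_refines[OF ch(2)] _ ch(3)] chain_ends[OF ch(2)] s(2) IH by simp
    then show ?thesis unfolding w IH[symmetric] by simp
  qed
qed (simp add: maxchain_def is_sat_chain_def)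

text \<open>The last cover is chosen first, by \<open>step_below\<close>. The labels below it are
  exactly \<open>gaps x z\<close>, all smaller than its label \<open>b\<close>.\<close>

lemma increasing_chain_exists:
  "x \<in> NC n \<Longrightarrow> y \<in> NC n \<Longrightarrow> refines x y \<Longrightarrow> \<exists>c. chain x y c \<and> sorted_wrt (<) (word c)"
proof (induction "card x - card y" arbitrary: y)
  case 0
  then have "x = y" using refines_card_less[of x y] by auto
  then show ?case using 0 by (intro exI[of _ "[x]"]) (simp add: chain_Nil_iff)
next
  case (Suc k)
  then have "x \<noteq> y" by auto
  then obtain z b where z: "nc_step z b y" "refines x z" "\<forall>a\<in>gaps x z. a < b"
    using step_below Suc by blast
  have zNC: "z \<in> NC n" using z(1) by (simp add: nc_step_def)
  have "k = card x - card z" using Suc(2) nc_step_card[OF z(1)] by simp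
  then obtain c where c: "chain x z c" "sorted_wrt (<) (word c)"
    using Suc(1)[of z] Suc(3) zNC z(2) by blast
  have ne: "c \<noteq> []" "last c = z" using c(1) chain_ends[OF c(1)] by (auto simp: maxchain_def)
  have "chain x y (c @ [y])" using c z covers_NC_iff ne by (auto simp: chain_snoc_iff)
  moreover have "word (c @ [y]) = word c @ [b]" using ne nc_step_label[OF z(1)] by (simp add: label_word_append)
  moreover have "sorted_wrt (<) (word c @ [b])"
    using c(2) z(3) set_increasing_word[OF c] by (auto simp: sorted_wrt_append)
  ultimately show ?case by metis
qed

section \<open>Recovering a chain from its word\<close>

lemma merge_inside:
  assumes "x \<in> NC n" "D \<in> x" "E \<in> x" "D \<noteq> E" "D \<union> E \<subseteq> S"
  shows "card {A\<in>x. A \<subseteq> S} = Suc (card {A\<in>merge x D E. A \<subseteq> S})"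
proof -
  let ?X = "{A\<in>x. A \<subseteq> S}"
  have fin: "finite ?X" using NC_finite_elem[OF assms(1)] by simp
  have DE: "{D, E} \<subseteq> ?X" using assms by auto
  have "{A\<in>merge x D E. A \<subseteq> S} = insert (D \<union> E) (?X - {D, E})"
    using assms(5) by (auto simp: merge_def)
  moreover have "card (insert (D \<union> E) (?X - {D, E})) = Suc (card (?X - {D, E}))"
    using fin Un_notin[OF assms(1-4)] by (intro card_insert_disjoint) auto
  moreover have "card (?X - {D, E}) = card ?X - card {D, E}" "card {D, E} \<le> card ?X"
    using fin DE by (intro card_Diff_subset card_mono; simp)+
  ultimately show ?thesis using assms(4) by simp
qed

text \<open>A label in \<open>E\<close> belongs to a merge inside \<open>E\<close>, which uses up
  one of the blocks inside \<open>E\<close>. The \<open>Suc\<close> accounts for \<open>E\<close>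
  itself, which is left at the end.\<close>

lemma count_labels_in_block:
  "chain x z c \<Longrightarrow> E \<in> z \<Longrightarrow> Suc (length (filter (\<lambda>a. a \<in> E) (word c))) \<le> card {A\<in>x. A \<subseteq> E}"
proof (induction c arbitrary: x rule: induct_list012)
  case (2 y)
  then have "x = z" "z \<in> NC n" by (auto simp: chain_Nil_iff)
  moreover have "{E} \<subseteq> {A\<in>z. A \<subseteq> E}" using 2 by simp
  ultimately show ?case using card_mono[of "{A\<in>z. A \<subseteq> E}" "{E}"] NC_finite_elem by simp
next
  case (3 w x' c)
  then have ch: "x = w" "chain x' z (x' # c)" and st: "nc_step x (nc_label x x') x'"
    using nc_step_of_cover by (auto simp: chain_Cons_iff)
  let ?a = "nc_label x x'"
  obtain F G where FG: "x \<in> NC n" "F \<in> x" "G \<in> x" "hooks F G ?a" "x' = merge x F G"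
    using st by (auto simp: nc_step_def)
  have x': "x' \<in> NC n" "z \<in> NC n" "refines x' z"
    using chain_ends[OF ch(2)] chain_refines[OF ch(2)] by blast+
  have IH: "Suc (length (filter (\<lambda>a. a \<in> E) (word (x' # c)))) \<le> card {A\<in>x'. A \<subseteq> E}"
    using "3.IH"(2)[OF ch(2) 3(4)] .
  show ?case
  proof (cases "F \<union> G \<subseteq> E")
    case True
    then show ?thesis using merge_inside[OF FG(1-3) hooks_neq[OF FG(4)] True] IH FG(5) ch(1) by simp
  next
    case False
    have "F \<union> G \<in> x'" using FG(5) by (simp add: merge_def)
    then have "?a \<notin> E" using refines_block[OF x' _ 3(4), of "F \<union> G" ?a] hooksD(1)[OF FG(4)] False by blast
    moreover have "{A\<in>x'. A \<subseteq> E} \<subseteq> {A\<in>x. A \<subseteq> E}" using False FG(5) by (auto simp: merge_def)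
    then have "card {A\<in>x'. A \<subseteq> E} \<le> card {A\<in>x. A \<subseteq> E}"
      using NC_finite_elem[OF FG(1)] by (intro card_mono) auto
    ultimately show ?thesis using IH ch(1) by simp
  qed
qed (simp add: maxchain_def is_sat_chain_def)

text \<open>At the top no block inside the proper initial segment \<open>S\<close> of
  \<open>C\<close> is left, so all of them must be absorbed, and each absorption costs a label in
  \<open>S\<close>.\<close>

lemma count_labels_initial:
  assumes "C \<in> z" "S \<subset> C" "\<And>s t. s \<in> S \<Longrightarrow> t \<in> C - S \<Longrightarrow> s < t"
  shows "chain x z c \<Longrightarrow> card {A\<in>x. A \<subseteq> S} \<le> length (filter (\<lambda>a. a \<in> S) (word c))"
proof (induction c arbitrary: x rule: induct_list012)
  case (2 y)
  then have x: "x = z" "z \<in> NC n" by (auto simp: chain_Nil_iff)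
  have emp: "{A\<in>z. A \<subseteq> S} = {}"
  proof (rule ccontr)
    assume "\<not> ?thesis"
    then obtain A where A: "A \<in> z" "A \<subseteq> S" by blast
    then have "A = C" using block_eq[OF x(2) A(1) assms(1)] block_ne[OF x(2) A(1)] assms(2) by blast
    then show False using A assms(2) by blast
  qed
  show ?case unfolding x(1) emp by simp
next
  case (3 w x' c)
  then have ch: "x = w" "chain x' z (x' # c)" and st: "nc_step x (nc_label x x') x'"
    using nc_step_of_cover by (auto simp: chain_Cons_iff)
  let ?a = "nc_label x x'"
  obtain F G where FG: "x \<in> NC n" "F \<in> x" "G \<in> x" "hooks F G ?a" "x' = merge x F G"
    using st by (auto simp: nc_step_def)
  have x': "x' \<in> NC n" "z \<in> NC n" "refines x' z"
    using chain_ends[OF ch(2)] chain_refines[OF ch(2)] by blast+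
  have IH: "card {A\<in>x'. A \<subseteq> S} \<le> length (filter (\<lambda>a. a \<in> S) (word (x' # c)))"
    using "3.IH"(2)[OF ch(2)] .
  note ne = hooks_neq[OF FG(4)] and h = hooksD[OF FG(4)]
  have fin: "finite {A\<in>x. A \<subseteq> S}" "finite {A\<in>x'. A \<subseteq> S}"
    using NC_finite_elem FG(1) x'(1) by auto
  show ?case
  proof (cases "?a \<in> S")
    case True
    have "card {A\<in>x. A \<subseteq> S} \<le> Suc (card {A\<in>x'. A \<subseteq> S})"
    proof (cases "F \<union> G \<subseteq> S")
      case True
      then show ?thesis using merge_inside[OF FG(1-3) ne True] FG(5) by simp
    next
      case False
      \<comment> \<open>As \<open>F\<close> and \<open>G\<close> are not both inside
        \<open>S\<close>, the merge absorbs at most one block \<open>H\<close> inside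
        \<open>S\<close>.\<close>
      then have "\<exists>H. {A\<in>x. A \<subseteq> S} \<subseteq> insert H {A\<in>x'. A \<subseteq> S}"
        using FG(5) by (cases "F \<subseteq> S") (auto simp: merge_def)
      then obtain H where "{A\<in>x. A \<subseteq> S} \<subseteq> insert H {A\<in>x'. A \<subseteq> S}" ..
      then have "card {A\<in>x. A \<subseteq> S} \<le> card (insert H {A\<in>x'. A \<subseteq> S})"
        using fin(2) by (intro card_mono) simp_all
      also have "\<dots> \<le> Suc (card {A\<in>x'. A \<subseteq> S})" using fin(2) by (simp add: card_insert_if)
      finally show ?thesis .
    qed
    then show ?thesis using IH ch(1) True by simp
  next
    case False
    have "\<not> F \<subseteq> S" using False h(1) by blast
    \<comment> \<open>A label outside \<open>S\<close> would lie in \<open>C\<close> beyond all of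
      \<open>S\<close>, yet it precedes all of \<open>G\<close>.\<close>
    moreover have "\<not> G \<subseteq> S"
    proof
      assume G: "G \<subseteq> S"
      obtain g where g: "g \<in> G" using block_ne[OF FG(1,3)] by blast
      have "F \<union> G \<in> x'" using FG(5) by (simp add: merge_def)
      then have "F \<union> G \<subseteq> C" using refines_block[OF x' _ assms(1), of "F \<union> G" g] g G assms(2) by blast
      then have "?a \<in> C - S" using h(1) False by blast
      then have "g < ?a" using assms(3) g G by blast
      then show False using h(2)[OF g] by simp
    qed
    ultimately have "{A\<in>x. A \<subseteq> S} \<subseteq> {A\<in>x'. A \<subseteq> S}" using FG(5) by (auto simp: merge_def)
    then have "card {A\<in>x. A \<subseteq> S} \<le> card {A\<in>x'. A \<subseteq> S}" using fin by (intro card_mono)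
    then show ?thesis using IH ch(1) False by simp
  qed
qed (simp add: maxchain_def is_sat_chain_def)

text \<open>Both \<open>E\<close> and \<open>E'\<close> follow \<open>b\<close> directly in the same
  block, so one is an initial segment of the other; the element \<open>e'\<close> shows that
  \<open>E\<close> is the shorter one.\<close>

lemma hooks_Un_initial:
  assumes "hooks D E b" "hooks D' E' b" "D \<union> E = D' \<union> E'" "E \<noteq> {}" "E' \<noteq> {}" "D \<inter> E = {}" "D' \<inter> E' = {}"
    and "e' \<in> E'" "e' \<notin> E"
  shows "E \<subset> E'" "\<And>s t. s \<in> E \<Longrightarrow> t \<in> E' - E \<Longrightarrow> s < t"
proof -
  note h = hooksD[OF assms(1)] and h' = hooksD[OF assms(2)]
  have "e' \<in> D" using assms by blast
  then have lt: "e < e'" if "e \<in> E" for e using h(3)[OF _ that] h'(2)[OF assms(8)] by blast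
  show sub: "E \<subset> E'"
  proof
    show "E \<subseteq> E'"
    proof (rule subsetI, rule ccontr)
      fix e assume e: "e \<in> E" "e \<notin> E'"
      then have "e \<in> D'" using assms(3) by blast
      then have "e' < e" using h'(3)[OF _ assms(8)] h(2)[OF e(1)] by blast
      then show False using lt[OF e(1)] by simp
    qed
  qed (use assms in blast)
  fix s t assume st: "s \<in> E" "t \<in> E' - E"
  then have "t \<in> D" "b < t" using assms(3) h'(2) by blast+
  then show "s < t" using h(3) st(1) by blast
qed

text \<open>The label \<open>b\<close> identifies the merged y-block. If one of \<open>E\<close>,
  \<open>E'\<close> were a proper initial segment of the other, the two counts would contradict each
  other: fewer labels in it than x-blocks by one chain, at least as many by the other.\<close>

lemma last_merge_unique:
  assumes c: "chain x z c" and d: "chain x z' d" and w: "word c = word d"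
    and s: "nc_step z b y" and s': "nc_step z' b y"
  shows "z = z'"
proof -
  obtain D E where z: "z \<in> NC n" "y \<in> NC n" and DE: "D \<in> z" "E \<in> z" "hooks D E b" "y = merge z D E"
    using s by (auto simp: nc_step_def)
  obtain D' E' where z': "z' \<in> NC n" and DE': "D' \<in> z'" "E' \<in> z'" "hooks D' E' b" "y = merge z' D' E'"
    using s' by (auto simp: nc_step_def)
  have dis: "D \<inter> E = {}" "D' \<inter> E' = {}"
    using block_eq[OF z(1) DE(1,2)] hooks_neq[OF DE(3)] block_eq[OF z' DE'(1,2)] hooks_neq[OF DE'(3)] by blast+
  have ne: "E \<noteq> {}" "E' \<noteq> {}" using block_ne[OF z(1) DE(2)] block_ne[OF z' DE'(2)] by blast+
  have "D \<union> E \<in> y" using DE(4) by (simp add: merge_def)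
  moreover have "D' \<union> E' \<in> y" using DE'(4) by (simp add: merge_def)
  ultimately have U: "D \<union> E = D' \<union> E'"
    using block_eq[OF z(2), of "D \<union> E" "D' \<union> E'" b] hooksD(1)[OF DE(3)] hooksD(1)[OF DE'(3)] by blast
  \<comment> \<open>Stated for arbitrary chains, because it is applied in both directions.\<close>
  have sub: "F' \<subseteq> F" if
    "chain x v e" "chain x v' e'" "word e = word e'" "F \<in> v" "F' \<in> v'" "hooks G F b" "hooks G' F' b"
    "G \<union> F = G' \<union> F'" "F \<noteq> {}" "F' \<noteq> {}" "G \<inter> F = {}" "G' \<inter> F' = {}" for v v' e e' F F' G G'
  proof (rule subsetI, rule ccontr)
    fix t assume "t \<in> F'" "t \<notin> F"
    note in' = hooks_Un_initial[OF that(6,7,8,9,10,11,12) this]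
    show False
      using count_labels_initial[OF that(5) in' that(2)] count_labels_in_block[OF that(1,4)] that(3) by simp
  qed
  have "E = E'"
    using sub[OF c d w DE(2) DE'(2) DE(3) DE'(3) U ne dis]
      sub[OF d c w[symmetric] DE'(2) DE(2) DE'(3) DE(3) U[symmetric] ne(2,1) dis(2,1)] by blast
  then have "D = D'" using U dis by blast
  \<comment> \<open>The partition before a merge is regained by splitting the union again.\<close>
  have split: "v = insert G (insert F (merge v G F - {G \<union> F}))" if "v \<in> NC n" "G \<in> v" "F \<in> v" "G \<noteq> F" for v G F
    using Un_notin[OF that] that by (auto simp: merge_def)
  show ?thesis
    using split[OF z(1) DE(1,2) hooks_neq[OF DE(3)]] split[OF z' DE'(1,2) hooks_neq[OF DE'(3)]]
      DE(4) DE'(4) \<open>E = E'\<close> \<open>D = D'\<close> by simp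
qed

text \<open>The chains are peeled from the top: equal words have equal last labels, which fixes the
  elements just below \<open>y\<close>.\<close>

lemma word_determines_chain:
  "chain x y c \<Longrightarrow> chain x y d \<Longrightarrow> word c = word d \<Longrightarrow> c = d"
proof (induction c arbitrary: y d rule: rev_induct)
  case (snoc y' c)
  note ends = chain_ends[OF snoc.prems(1)] chain_ends[OF snoc.prems(2)]
  have len: "length (c @ [y']) = length d"
    using arg_cong[OF snoc.prems(3), of length] ends by (cases d) auto
  obtain d' y'' where d: "d = d' @ [y'']" using ends by (metis rev_exhaust)
  show ?case
  proof (cases "c = []")
    case True
    then show ?thesis using snoc.prems len d by (auto simp: chain_Nil_iff)
  next
    case False
    then have d': "d' \<noteq> []" using len d by auto
    let ?z = "last c" and ?z' = "last d'"
    have c: "y' = y" "chain x ?z c" "nc_step ?z (nc_label ?z y) y"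
      using snoc.prems(1) False nc_step_of_cover by (auto simp: chain_snoc_iff)
    have dd: "y'' = y" "chain x ?z' d'" "nc_step ?z' (nc_label ?z' y) y"
      using snoc.prems(2) d d' nc_step_of_cover by (auto simp: chain_snoc_iff)
    have w: "word c = word d'" "nc_label ?z y = nc_label ?z' y"
      using snoc.prems(3) False d d' c(1) dd(1) by (simp_all add: label_word_append)
    have "?z = ?z'" using last_merge_unique[OF c(2) dd(2) w(1) c(3)] dd(3) w(2) by simp
    then have "c = d'" using snoc.IH[OF c(2) _ w(1)] dd(2) by simp
    then show ?thesis using c(1) dd(1) d by simp
  qed
qed (simp add: maxchain_def is_sat_chain_def)

section \<open>The conditions of an EW-labeling\<close>

theorem EW_labeling_NC: "EW_labeling (NC n) refines (NC_bot n) nc_label"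
  unfolding EW_labeling_def
proof (intro conjI)
  show "ER_labeling (NC n) refines nc_label"
    unfolding ER_labeling_def increasing_word_def
  proof (intro ballI impI)
    fix x y assume xy: "x \<in> NC n" "y \<in> NC n" "refines x y"
    show "\<exists>!c. chain x y c \<and> sorted_wrt (<) (word c)"
    proof (rule ex_ex1I)
      fix c d assume c: "chain x y c \<and> sorted_wrt (<) (word c)" and d: "chain x y d \<and> sorted_wrt (<) (word d)"
      \<comment> \<open>Both words list the set \<open>gaps x y\<close> in increasing order, so they
        coincide.\<close>
      then have "set (word c) = set (word d)" using set_increasing_word by blast
      then have "word c = word d" using c d by (metis strict_sorted_equal)
      then show "c = d" using c d word_determines_chain by blast
    qed (rule increasing_chain_exists[OF xy])
  qed
  show "rank_two_switching (NC n) refines (NC_bot n) nc_label"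
    unfolding rank_two_switching_def
  proof (intro allI impI)
    fix c i assume h: "is_sat_chain (NC n) refines c \<and> hd c = NC_bot n \<and> 0 < i \<and> Suc i < length c \<and>
        nc_label (c ! (i - 1)) (c ! i) < nc_label (c ! i) (c ! Suc i)"
    let ?x = "c ! (i - 1)" and ?z = "c ! i" and ?y = "c ! Suc i"
    let ?a = "nc_label ?x ?z" and ?b = "nc_label ?z ?y"
    have "Suc (i - 1) < length c" "Suc (i - 1) = i" using h by auto
    then have "covers (NC n) refines ?x ?z" "covers (NC n) refines ?z ?y"
      using h unfolding is_sat_chain_def by metis+
    then obtain z' where z': "nc_step ?x ?b z'" "nc_step z' ?a ?y"
      using nc_switch[OF nc_step_of_cover nc_step_of_cover] h by blast
    show "\<exists>!x'. covers (NC n) refines ?x x' \<and> covers (NC n) refines x' ?y \<and>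
      nc_label ?x x' = ?b \<and> nc_label x' ?y = ?a"
    proof (rule ex1I[of _ z'])
      show "covers (NC n) refines ?x z' \<and> covers (NC n) refines z' ?y \<and>
        nc_label ?x z' = ?b \<and> nc_label z' ?y = ?a"
        using z' covers_NC_iff nc_step_label by blast
    next
      fix v assume v: "covers (NC n) refines ?x v \<and> covers (NC n) refines v ?y \<and>
        nc_label ?x v = ?b \<and> nc_label v ?y = ?a"
      \<comment> \<open>Two candidates for the switch would give two chains of one interval with the
        same word.\<close>
      have "chain ?x ?y [?x, v, ?y]" "chain ?x ?y [?x, z', ?y]"
        using v z' covers_NC_iff by (auto simp: maxchain_def dest: covers_in)
      moreover have "word [?x, v, ?y] = word [?x, z', ?y]" using v z' nc_step_label by simp
      ultimately have "[?x, v, ?y] = [?x, z', ?y]" by (rule word_determines_chain)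
      then show "v = z'" by simp
    qed
  qed
  show "\<forall>x y c d. chain x y c \<and> chain x y d \<and> c \<noteq> d \<longrightarrow> word c \<noteq> word d"
    using word_determines_chain by blast
qed

end

theorem theorem5p6:
  fixes n :: nat
  assumes "n \<ge> 1"
  shows "EW_labeling (NC n) refines (NC_bot n) nc_label \<and>
         whitney_duals (NC n) refines (NC_bot n)
           (Q_carrier (NC n) refines (NC_bot n) nc_label)
           (Q_le (NC n) refines (NC_bot n) nc_label)
           (Q_bot (NC n) refines (NC_bot n) nc_label)"
proof -
  interpret EW_poset "NC n" refines "NC_bot n" nc_label
    by unfold_locales (rule graded_NC EW_labeling_NC)+
  show ?thesis using EW_labeling_NC Q_whitney_dual by blast
qed

end
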